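(* Let $s$ be a discrete analytic Schur function. Then $s$ belongs to the Hardy space $\mathbf{H}_2(\Lambda_+)$, and for every $f\in\mathbf{H}_2(\Lambda_+)$ the convolution product $$(s\odot f)(z)=\sum_{n=0}^\infty\sum_{m=0}^n\hat s(m)\hat f(n-m)z^{(n)}$$ converges absolutely in $\Lambda_+$ to a discrete analytic function. Moreover, the linear operator $$M_sf=s\odot f$$ is a contraction on $\mathbf{H}_2(\Lambda_+)$. Conversely, if $s\in\mathbf{H}_2(\Lambda_+)$ is such that the multiplication operator $M_s$ is a contraction on $\mathbf{H}_2(\Lambda_+)$, then $s$ is a discrete analytic Schur function.
   Context: Let $\Lambda=\mathbb{Z}+i\mathbb{Z}\subset\mathbb{C}$ and $\Lambda_+=\{z\in\Lambda:\operatorname{Re}(z)\ge 0\}$. A function $f$ on $\Lambda$ (respectively $\Lambda_+$) is discrete analytic if $$\frac{f(z+1+i)-f(z)}{1+i}=\frac{f(z+1)-f(z+i)}{1-i}$$ for all $z\in\Lambda$ (respectively $z\in\Lambda_+$). A path from $a$ to $b$ is a finite sequence $\gamma=(z_0,\ldots,z_n)$ of lattice points with $z_0=a$, $z_n=b$, $|z_k-z_{k-1}|=1$, and $\int_\gamma f\,\delta z=\sum_{k=1}^n\frac{f(z_{k-1})+f(z_k)}{2}(z_k-z_{k-1})$. For a discrete analytic $f$ this integral depends only on the endpoints (for $f$ defined on $\Lambda_+$, paths are taken in $\Lambda_+$). Define $$(Zf)(z)=\frac{f(0)-f(z)}{2}+\int_0^z f\,\delta z.$$ For $n\ge 0$,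 $z^{(n)}:=(Z^n1)(z)$, a discrete analytic polynomial of degree $n$. If $\limsup_n|\hat f(n)|^{1/n}<\sqrt2$, the series $\sum_n\hat f(n)z^{(n)}$ converges absolutely on $\Lambda_+$ to a discrete analytic function $f$ that determines the coefficients $\hat f(n)$ uniquely. The Hardy space $\mathbf{H}_2(\Lambda_+)$ is the Hilbert space of functions $f(z)=\sum_{n=0}^\infty\hat f(n)z^{(n)}$ on $\Lambda_+$ with $\sum_n|\hat f(n)|^2<\infty$, with inner product $\langle f,g\rangle=\sum_{n=0}^\infty\hat f(n)\overline{\hat g(n)}$. A function $s$ discrete analytic on $\Lambda_+$ is called a discrete analytic Schur function if $$\sum_{n=0}^\infty|(Z^ns)(z)|^2<\infty\quad\text{for all }z\in\Lambda_+,$$ and the kernel $$K^s_w(z)=\sum_{n=0}^\infty\left(z^{(n)}\,\overline{w^{(n)}}-(Z^ns)(z)\,\overline{(Z^ns)(w)}\right)$$ is positive in $\Lambda_+$, i.e. $\sum_{j,k=1}^N c_j\overline{c_k}\,K^s_{w_k}(w_j)\ge 0$ for all $N\ge1$, $w_1,\ldots,w_N\in\Lambda_+$, $c_1,\ldots,c_N\in\mathbb{C}$. A contraction on a Hilbert space is a linear operator of the space into itself with operator norm at most $1$. *)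

theory Defs
  imports "HOL-Analysis.Analysis"
begin

(* Functions on a set D of lattice points are represented by functions complex => complex of
   which only the values on D matter. *)

definition full_lattice :: "complex set" where
  "full_lattice = {z. Re z \<in> \<int> \<and> Im z \<in> \<int>}"

definition half_lattice :: "complex set" where
  "half_lattice = {z \<in> full_lattice. 0 \<le> Re z}"

definition discrete_analytic_on :: "complex set \<Rightarrow> (complex \<Rightarrow> complex) \<Rightarrow> bool" where
  "discrete_analytic_on D f \<longleftrightarrow>
     (\<forall>z\<in>D. (f (z + 1 + \<i>) - f z) / (1 + \<i>) = (f (z + 1) - f (z + \<i>)) / (1 - \<i>))"

definition lattice_path :: "complex set \<Rightarrow> complex \<Rightarrow> complex \<Rightarrow> complex list \<Rightarrow> bool" where
  "lattice_path D a b p \<longleftrightarrow>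
     p \<noteq> [] \<and> set p \<subseteq> D \<and> hd p = a \<and> last p = b \<and>
     (\<forall>k\<in>{1..<length p}. cmod (p ! k - p ! (k - 1)) = 1)"

definition path_integral :: "complex list \<Rightarrow> (complex \<Rightarrow> complex) \<Rightarrow> complex" where
  "path_integral p f =
     (\<Sum>k = 1..<length p. (f (p ! (k - 1)) + f (p ! k)) / 2 * (p ! k - p ! (k - 1)))"

(* The common value of the integrals over all paths in D from a to b; meaningful when
   the integral is path independent, in particular for f discrete analytic on D and D one of
   the two lattices above. *)
definition discrete_integral ::
    "complex set \<Rightarrow> complex \<Rightarrow> complex \<Rightarrow> (complex \<Rightarrow> complex) \<Rightarrow> complex" where
  "discrete_integral D a b f = (THE I. \<forall>p. lattice_path D a b p \<longrightarrow> path_integral p f = I)"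

definition Z_op :: "complex set \<Rightarrow> (complex \<Rightarrow> complex) \<Rightarrow> complex \<Rightarrow> complex" where
  "Z_op D f z = (f 0 - f z) / 2 + discrete_integral D 0 z f"

definition dpow :: "nat \<Rightarrow> complex \<Rightarrow> complex" where
  "dpow n = (Z_op full_lattice ^^ n) (\<lambda>_. 1)"

(* The coefficient sequence of f; the growth condition is the one under which the expansion
   converges on the half lattice and the coefficients are unique. *)
definition dcoeff :: "(complex \<Rightarrow> complex) \<Rightarrow> nat \<Rightarrow> complex" where
  "dcoeff f = (THE c. limsup (\<lambda>n. ereal (root n (cmod (c n)))) < ereal (sqrt 2) \<and>
                      (\<forall>z\<in>half_lattice. (\<lambda>n. c n * dpow n z) sums f z))"

definition hardy_space :: "(complex \<Rightarrow> complex) set" where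
  "hardy_space = {f. \<exists>c. summable (\<lambda>n. (cmod (c n))\<^sup>2) \<and>
                         (\<forall>z\<in>half_lattice. (\<lambda>n. c n * dpow n z) sums f z)}"

definition hardy_inner :: "(complex \<Rightarrow> complex) \<Rightarrow> (complex \<Rightarrow> complex) \<Rightarrow> complex" where
  "hardy_inner f g = (\<Sum>n. dcoeff f n * cnj (dcoeff g n))"

definition hardy_norm :: "(complex \<Rightarrow> complex) \<Rightarrow> real" where
  "hardy_norm f = sqrt (Re (hardy_inner f f))"

(* Elements of the Hardy space are functions on the half lattice, so equality of two of them
   is equality there. *)
definition hardy_contraction :: "((complex \<Rightarrow> complex) \<Rightarrow> (complex \<Rightarrow> complex)) \<Rightarrow> bool" where
  "hardy_contraction T \<longleftrightarrow>
     (\<forall>f\<in>hardy_space. T f \<in> hardy_space) \<and>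
     (\<forall>f\<in>hardy_space. \<forall>g\<in>hardy_space. \<forall>a b. \<forall>z\<in>half_lattice.
        T (\<lambda>w. a * f w + b * g w) z = a * T f z + b * T g z) \<and>
     (\<forall>f\<in>hardy_space. hardy_norm (T f) \<le> hardy_norm f)"

definition conv_coeff :: "(complex \<Rightarrow> complex) \<Rightarrow> (complex \<Rightarrow> complex) \<Rightarrow> nat \<Rightarrow> complex" where
  "conv_coeff s f n = (\<Sum>m\<le>n. dcoeff s m * dcoeff f (n - m))"

definition conv_prod ::
    "(complex \<Rightarrow> complex) \<Rightarrow> (complex \<Rightarrow> complex) \<Rightarrow> complex \<Rightarrow> complex" where
  "conv_prod s f z = (\<Sum>n. conv_coeff s f n * dpow n z)"

definition schur_kernel :: "(complex \<Rightarrow> complex) \<Rightarrow> complex \<Rightarrow> complex \<Rightarrow> complex" where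
  "schur_kernel s w z =
     (\<Sum>n. dpow n z * cnj (dpow n w)
           - (Z_op half_lattice ^^ n) s z * cnj ((Z_op half_lattice ^^ n) s w))"

definition positive_kernel_on :: "complex set \<Rightarrow> (complex \<Rightarrow> complex \<Rightarrow> complex) \<Rightarrow> bool" where
  "positive_kernel_on D K \<longleftrightarrow>
     (\<forall>N\<ge>1. \<forall>w c :: nat \<Rightarrow> complex. (\<forall>j\<in>{1..N}. w j \<in> D) \<longrightarrow>
        (\<Sum>j=1..N. \<Sum>k=1..N. c j * cnj (c k) * K (w k) (w j)) \<in> \<real>\<^sub>\<ge>\<^sub>0)"

definition discrete_analytic_schur :: "(complex \<Rightarrow> complex) \<Rightarrow> bool" where
  "discrete_analytic_schur s \<longleftrightarrow>
     discrete_analytic_on half_lattice s \<and>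
     (\<forall>z\<in>half_lattice. summable (\<lambda>n. (cmod ((Z_op half_lattice ^^ n) s z))\<^sup>2)) \<and>
     positive_kernel_on half_lattice (schur_kernel s)"

end

theory Submission
  imports Defs
begin

text \<open>
  Identify a function in the Hardy space with its coefficient sequence \<open>c\<close>, and let \<open>v z\<close> be the
  sequence \<open>n \<mapsto> dpow n z\<close>, so that the function is the pairing of \<open>c\<close> with \<open>v z\<close>. Multiplication by \<open>s\<close> is then
  the lower triangular Toeplitz matrix \<open>T\<close> of \<open>dcoeff s\<close>, and its transpose sends \<open>v z\<close> to
  \<open>\<sigma> z\<close>, the sequence \<open>n \<mapsto> (Z\<^sup>n s) z\<close>, because \<open>Z\<close> raises the index of every power by one
  (\<open>Z_iterate_dpow_series\<close>). Positivity of the kernel says that combinations of the \<open>\<sigma> z\<close> are no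
  longer than the same combinations of the \<open>v z\<close> (\<open>gram_difference_positive_iff\<close>). If \<open>T\<close> is a
  contraction, so is its transpose, and the kernel is positive.

  Conversely, let \<open>s\<close> be a Schur function, of which no series expansion is known at first. On the
  nonnegative integers \<open>dpow n x\<close> is the binomial coefficient, so the Newton coefficients \<open>c\<close> of \<open>s\<close>
  exist, and the combinations of the \<open>v x\<close> at these points \<open>x\<close> are all the finitely supported
  sequences. On these, passing from \<open>v\<close> to \<open>\<sigma>\<close> is the transposed Toeplitz matrix of \<open>c\<close>
  (\<open>Z_iterate_at_nat\<close>), which therefore is a contraction; in particular \<open>c\<close>, a column of a
  contraction, is square summable. At any other point \<open>w\<close>, truncations of \<open>v w\<close> are finitely supported and
  converge to \<open>v w\<close>, so their images converge to \<open>\<sigma> w\<close>. The entry of index \<open>0\<close> of this limit is the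
  expansion of \<open>s w\<close> with coefficients \<open>c\<close> (\<open>discrete_analytic_schur_toeplitz\<close>).

  Two facts keep the analysis elementary. The sequence \<open>v z\<close> is absolutely summable for every \<open>z\<close> in the half lattice
  (\<open>dpow_abs_summable\<close>), so every series with bounded coefficients converges there. And a triangular matrix is a
  contraction as soon as its finite sections are, so that the duality between \<open>T\<close> and its transpose
  is a statement about finite matrices (\<open>contractive_matrix_transpose\<close>).
\<close>

section \<open>Discrete integration and the operator \<open>Z\<close>\<close>

definition lattice_domain :: "complex set \<Rightarrow> bool" where
  "lattice_domain D \<longleftrightarrow> D = full_lattice \<or> D = half_lattice"

lemma lattice_domain_facts:
  assumes "lattice_domain D"
  shows "0 \<in> D" "z \<in> D \<Longrightarrow> z + 1 \<in> D" "z \<in> D \<Longrightarrow> z + \<i> \<in> D" "D \<subseteq> full_lattice"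
  using assms by (auto simp: lattice_domain_def full_lattice_def half_lattice_def)

lemma lattice_domain_full: "lattice_domain full_lattice"
  and lattice_domain_half: "lattice_domain half_lattice"
  by (auto simp: lattice_domain_def)

lemma nat_in_half_lattice: "of_nat n \<in> half_lattice"
  by (auto simp: half_lattice_def full_lattice_def)

text \<open>Both lattices are connected through steps by \<open>1\<close> and \<open>\<i>\<close> taken in either direction, so a
  property that holds at the origin and passes across every such step holds everywhere.\<close>

lemma lattice_induct [consumes 2, case_names origin right up]:
  assumes D: "lattice_domain D" and z: "z \<in> D"
    and 0: "P 0"
    and right: "\<And>z. z \<in> D \<Longrightarrow> P z \<longleftrightarrow> P (z + 1)"
    and up: "\<And>z. z \<in> D \<Longrightarrow> P z \<longleftrightarrow> P (z + \<i>)"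
  shows "P z"
proof -
  have imag: "Complex 0 (of_int n) \<in> D" for n
    using D by (auto simp: lattice_domain_def full_lattice_def half_lattice_def)
  have col: "P (Complex 0 (of_int n))" for n
  proof (induction n rule: int_induct[where k = 0])
    case base
    have "Complex 0 (of_int 0) = 0" by (simp add: complex_eq_iff)
    then show ?case using 0 by metis
  next
    case (step1 i)
    have "Complex 0 (of_int i) + \<i> = Complex 0 (of_int (i + 1))" by (simp add: complex_eq_iff)
    then show ?case using up[OF imag[of i]] step1 by metis
  next
    case (step2 i)
    have "Complex 0 (of_int (i - 1)) + \<i> = Complex 0 (of_int i)" by (simp add: complex_eq_iff)
    then show ?case using up[OF imag[of "i - 1"]] step2 by metis
  qed
  have row: "Complex (of_int m) (of_int n) \<in> D \<longrightarrow> P (Complex (of_int m) (of_int n))" for m n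
  proof (induction m rule: int_induct[where k = 0])
    case base
    then show ?case using col by simp
  next
    case (step1 i)
    have e: "Complex (of_int i) (of_int n) + 1 = Complex (of_int (i + 1)) (of_int n)"
      by (simp add: complex_eq_iff)
    have "Complex (of_int i) (of_int n) \<in> D"
      using D step1 by (auto simp: lattice_domain_def full_lattice_def half_lattice_def)
    then show ?case using right e step1 by metis
  next
    case (step2 i)
    have e: "Complex (of_int (i - 1)) (of_int n) + 1 = Complex (of_int i) (of_int n)"
      by (simp add: complex_eq_iff)
    show ?case
      using right e step2 lattice_domain_facts(2)[OF D] by metis
  qed
  have "z \<in> full_lattice" using z lattice_domain_facts(4)[OF D] by blast
  then obtain m n where "Re z = of_int m" "Im z = of_int n"
    by (auto simp: full_lattice_def elim!: Ints_cases)
  then have "z = Complex (of_int m) (of_int n)" by (simp add: complex_eq_iff)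
  then show ?thesis using row z by metis
qed

text \<open>On the half lattice a step to the right need only be followed forwards.\<close>

lemma half_lattice_induct [consumes 1, case_names origin right up]:
  assumes z: "z \<in> half_lattice"
    and 0: "P 0"
    and right: "\<And>z. z \<in> half_lattice \<Longrightarrow> P z \<Longrightarrow> P (z + 1)"
    and up: "\<And>z. z \<in> half_lattice \<Longrightarrow> P z \<longleftrightarrow> P (z + \<i>)"
  shows "P z"
proof -
  have mem: "Complex (of_nat k) (Im z) \<in> half_lattice" if "z \<in> half_lattice" for k z
    using that by (auto simp: half_lattice_def full_lattice_def)
  have axis: "P (Complex 0 (Im z))"
    using lattice_domain_half z
  proof (induction rule: lattice_induct)
    case origin
    have "Complex 0 (Im 0) = 0" by (simp add: complex_eq_iff)
    then show ?case using 0 by simp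
  next
    case (up z)
    have "Complex 0 (Im (z + \<i>)) = Complex 0 (Im z) + \<i>" by (simp add: complex_eq_iff)
    then show ?case using assms(4) mem[OF up, of 0] by simp
  qed simp
  have "P (Complex (of_nat k) (Im z))" for k
  proof (induction k)
    case (Suc k)
    have "Complex (of_nat (Suc k)) (Im z) = Complex (of_nat k) (Im z) + 1"
      by (simp add: complex_eq_iff)
    then show ?case using right[OF mem[OF z] Suc] by simp
  qed (use axis in simp)
  moreover obtain m where m: "Re z = of_int m" "0 \<le> m"
    using z by (auto simp: half_lattice_def full_lattice_def elim!: Ints_cases)
  then have "z = Complex (of_nat (nat m)) (Im z)" by (simp add: complex_eq_iff)
  ultimately show ?thesis by metis
qed

lemma lattice_path_exists:
  assumes D: "lattice_domain D" and z: "z \<in> D"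
  shows "\<exists>p. lattice_path D 0 z p"
proof -
  have extend: "\<exists>p. lattice_path D 0 b p"
    if p: "lattice_path D 0 a p" and b: "b \<in> D" "cmod (b - a) = 1" for a b p
  proof
    show "lattice_path D 0 b (p @ [b])"
      unfolding lattice_path_def
    proof (intro conjI ballI)
      fix k assume k: "k \<in> {1..<length (p @ [b])}"
      show "cmod ((p @ [b]) ! k - (p @ [b]) ! (k - 1)) = 1"
      proof (cases "k = length p")
        case True
        then have "(p @ [b]) ! (k - 1) = a"
          using p k by (auto simp: lattice_path_def nth_append last_conv_nth)
        then show ?thesis using b True by simp
      next
        case False
        then show ?thesis
          using p k by (auto simp: lattice_path_def nth_append)
      qed
    qed (use p b in \<open>auto simp: lattice_path_def\<close>)
  qed
  show ?thesis
    using D z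
  proof (induction rule: lattice_induct)
    case origin
    have "lattice_path D 0 0 [0]"
      using lattice_domain_facts(1)[OF D] by (simp add: lattice_path_def)
    then show ?case by blast
  next
    case (right z)
    then show ?case
      using extend[of z _ "z + 1"] extend[of "z + 1" _ z] lattice_domain_facts(2)[OF D] by auto
  next
    case (up z)
    then show ?case
      using extend[of z _ "z + \<i>"] extend[of "z + \<i>" _ z] lattice_domain_facts(3)[OF D] by auto
  qed
qed

lemma unit_step_cases:
  assumes "z \<in> full_lattice" "z' \<in> full_lattice" "cmod (z' - z) = 1"
  obtains "z' = z + 1" | "z = z' + 1" | "z' = z + \<i>" | "z = z' + \<i>"
proof -
  obtain a b c d where e: "Re z = of_int a" "Im z = of_int b" "Re z' = of_int c" "Im z' = of_int d"
    using assms by (auto simp: full_lattice_def elim!: Ints_cases)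
  have "(Re (z' - z))\<^sup>2 + (Im (z' - z))\<^sup>2 = 1"
    using assms(3) cmod_power2[of "z' - z"] by simp
  then have "real_of_int ((c - a)\<^sup>2 + (d - b)\<^sup>2) = 1" by (simp add: e)
  then have s: "(c - a)\<^sup>2 + (d - b)\<^sup>2 = 1" by linarith
  have "(c - a = 0 \<or> (c-a)\<^sup>2 \<ge> 1)" "(d - b = 0 \<or> (d-b)\<^sup>2 \<ge> 1)"
    by (auto simp: int_one_le_iff_zero_less)
  with s have "(c - a = 0 \<and> (d - b)\<^sup>2 = 1) \<or> (d - b = 0 \<and> (c - a)\<^sup>2 = 1)"
    by (smt (verit) zero_le_power2 power2_eq_square mult_zero_left)
  then have "(c - a = 0 \<and> (d - b = 1 \<or> d - b = -1)) \<or> (d - b = 0 \<and> (c - a = 1 \<or> c - a = -1))"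
    by (simp add: power2_eq_1_iff)
  then consider "c = a" "d = b + 1" | "c = a" "b = d + 1" | "d = b" "c = a + 1" | "d = b" "a = c + 1"
    by force
  then show thesis
    by cases (use e that in \<open>auto simp: complex_eq_iff\<close>)
qed

text \<open>A discrete primitive: the trapezoidal rule is exact along every lattice edge.\<close>

definition discrete_primitive :: "complex set \<Rightarrow> (complex \<Rightarrow> complex) \<Rightarrow> (complex \<Rightarrow> complex) \<Rightarrow> bool"
  where "discrete_primitive D f F \<longleftrightarrow> F 0 = 0 \<and>
    (\<forall>z\<in>D. F (z + 1) = F z + (f z + f (z + 1)) / 2) \<and>
    (\<forall>z\<in>D. F (z + \<i>) = F z + \<i> * (f z + f (z + \<i>)) / 2)"

text \<open>The integral along a path telescopes, so it depends only on the endpoints.\<close>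

lemma path_integral_primitive:
  assumes D: "D \<subseteq> full_lattice" and F: "discrete_primitive D f F" and p: "lattice_path D a b p"
  shows "path_integral p f = F b - F a"
proof -
  have ne: "p \<noteq> []" using p by (simp add: lattice_path_def)
  have "path_integral p f = (\<Sum>k = 1..<length p. F (p ! k) - F (p ! (k - 1)))"
    unfolding path_integral_def
  proof (rule sum.cong[OF refl])
    fix k assume k: "k \<in> {1..<length p}"
    define z z' where "z = p ! (k - 1)" and "z' = p ! k"
    have mem: "z \<in> D" "z' \<in> D" using p k by (auto simp: lattice_path_def z_def z'_def)
    have "cmod (z' - z) = 1" using p k by (auto simp: lattice_path_def z_def z'_def)
    then have "(f z + f z') / 2 * (z' - z) = F z' - F z"
    proof (rule unit_step_cases[rotated 2])
      show "z \<in> full_lattice" "z' \<in> full_lattice" using mem D by auto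
    next
      assume e: "z' = z + 1"
      then show ?thesis using F mem by (simp add: discrete_primitive_def)
    next
      assume e: "z = z' + 1"
      then have "F z = F z' + (f z' + f z) / 2" using F mem by (simp add: discrete_primitive_def)
      then show ?thesis using e by (simp add: field_simps)
    next
      assume e: "z' = z + \<i>"
      then have "F z' = F z + \<i> * (f z + f z') / 2" using F mem by (simp add: discrete_primitive_def)
      then show ?thesis using e by (simp add: field_simps)
    next
      assume e: "z = z' + \<i>"
      then have "F z = F z' + \<i> * (f z' + f z) / 2" using F mem by (simp add: discrete_primitive_def)
      then show ?thesis using e by (simp add: field_simps)
    qed
    then show "(f (p ! (k - 1)) + f (p ! k)) / 2 * (p ! k - p ! (k - 1)) = F (p ! k) - F (p ! (k - 1))"
      by (simp add: z_def z'_def)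
  qed
  also have "\<dots> = (\<Sum>k<length p - 1. F (p ! Suc k) - F (p ! k))"
    by (rule sum.reindex_bij_witness[where i = Suc and j = "\<lambda>k. k - 1"]) auto
  also have "\<dots> = F (p ! (length p - 1)) - F (p ! 0)"
    by (rule sum_lessThan_telescope)
  also have "\<dots> = F b - F a"
    using p ne by (simp add: lattice_path_def last_conv_nth hd_conv_nth)
  finally show ?thesis .
qed

lemma discrete_integral_primitive:
  assumes D: "lattice_domain D" and F: "discrete_primitive D f F" and z: "z \<in> D"
  shows "discrete_integral D 0 z f = F z"
  unfolding discrete_integral_def
proof (rule the_equality)
  have I: "path_integral p f = F z" if "lattice_path D 0 z p" for p
    using path_integral_primitive[OF lattice_domain_facts(4)[OF D] F that] F
    by (simp add: discrete_primitive_def)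
  then show "\<forall>p. lattice_path D 0 z p \<longrightarrow> path_integral p f = F z" by blast
  show "I = F z" if "\<forall>p. lattice_path D 0 z p \<longrightarrow> path_integral p f = I" for I
    using that I lattice_path_exists[OF D z] by metis
qed

text \<open>The sum is oriented, as an integral from \<open>0\<close> to \<open>n\<close>, so that its increments are \<open>h\<close> on both
  sides of the origin.\<close>

definition signed_sum :: "(int \<Rightarrow> complex) \<Rightarrow> int \<Rightarrow> complex" where
  "signed_sum h n = sum h {0..<n} - sum h {n..<0}"

lemma signed_sum_0 [simp]: "signed_sum h 0 = 0"
  by (simp add: signed_sum_def)

lemma signed_sum_step: "signed_sum h (n + 1) = signed_sum h n + h n"
proof (cases "n \<ge> 0")
  case True
  then have "{0..<n + 1} = insert n {0..<n}" by auto
  then show ?thesis using True by (simp add: signed_sum_def)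
next
  case False
  then have "{n..<0} = insert n {n + 1..<0}" by auto
  then show ?thesis using False by (simp add: signed_sum_def)
qed

lemma discrete_analytic_square:
  assumes "discrete_analytic_on D f" "z \<in> D"
  shows "f z + \<i> * f (z + 1) = f (z + 1 + \<i>) + \<i> * f (z + \<i>)"
proof -
  have c: "(1 + \<i>) \<noteq> 0" "1 - \<i> \<noteq> 0" by (auto simp: complex_eq_iff)
  have "(f (z + 1 + \<i>) - f z) / (1 + \<i>) = (f (z + 1) - f (z + \<i>)) / (1 - \<i>)"
    using assms by (auto simp: discrete_analytic_on_def)
  then have "(f (z + 1 + \<i>) - f z) * (1 - \<i>) = (f (z + 1) - f (z + \<i>)) * (1 + \<i>)"
    using c by (simp add: frac_eq_eq)
  then have "(1 + \<i>) * ((f (z + 1 + \<i>) - f z) * (1 - \<i>)) = (1 + \<i>) * ((f (z + 1) - f (z + \<i>)) * (1 + \<i>))"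
    by simp
  then have "2 * (f z + \<i> * f (z + 1)) = 2 * (f (z + 1 + \<i>) + \<i> * f (z + \<i>))"
    by (simp add: algebra_simps)
  then show ?thesis by (simp only: mult_cancel_left) simp
qed

lemma discrete_analytic_onI:
  assumes "\<And>z. z \<in> D \<Longrightarrow> f z + \<i> * f (z + 1) = f (z + 1 + \<i>) + \<i> * f (z + \<i>)"
  shows "discrete_analytic_on D f"
  unfolding discrete_analytic_on_def
proof
  fix z assume "z \<in> D"
  have c: "(1 + \<i>) \<noteq> 0" "1 - \<i> \<noteq> 0" by (auto simp: complex_eq_iff)
  have e: "f (z + 1 + \<i>) - f z = \<i> * (f (z + 1) - f (z + \<i>))"
    using assms[OF \<open>z \<in> D\<close>] by (simp add: algebra_simps)
  show "(f (z + 1 + \<i>) - f z) / (1 + \<i>) = (f (z + 1) - f (z + \<i>)) / (1 - \<i>)"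
    unfolding e using c by (simp add: frac_eq_eq algebra_simps)
qed

text \<open>Integrate up the imaginary axis and then along the row. The edge rule for vertical edges
  spreads from the imaginary axis to the neighbouring columns because discrete analyticity says
  exactly that the integral around each unit square vanishes.\<close>

lemma discrete_primitive_exists:
  assumes D: "lattice_domain D" and f: "discrete_analytic_on D f"
  obtains F where "discrete_primitive D f F"
proof -
  define pt where "pt m n = Complex (of_int m) (of_int n)" for m n
  define hor where "hor n m = (f (pt m n) + f (pt (m + 1) n)) / 2" for m n
  define ver where "ver n = \<i> * (f (pt 0 n) + f (pt 0 (n + 1))) / 2" for n
  define F where "F z = signed_sum ver \<lfloor>Im z\<rfloor> + signed_sum (hor \<lfloor>Im z\<rfloor>) \<lfloor>Re z\<rfloor>" for z
  have pt_steps: "pt m n + 1 = pt (m + 1) n" "pt m n + \<i> = pt m (n + 1)" for m n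
    by (auto simp: pt_def complex_eq_iff)
  have F_pt: "F (pt m n) = signed_sum ver n + signed_sum (hor n) m" for m n
    by (simp add: F_def pt_def)
  have pt_ex: "\<exists>m n. z = pt m n" if "z \<in> D" for z
  proof -
    have "z \<in> full_lattice" using that lattice_domain_facts(4)[OF D] by blast
    then show ?thesis
      by (auto simp: full_lattice_def pt_def complex_eq_iff elim!: Ints_cases)
  qed
  have F_right: "F (z + 1) = F z + (f z + f (z + 1)) / 2" if "z \<in> D" for z
    using pt_ex[OF that] by (auto simp: pt_steps F_pt signed_sum_step hor_def)
  have Re_mem: "Complex (Re z) (of_int n) \<in> D" if "z \<in> D" for z n
    using D that by (auto simp: lattice_domain_def full_lattice_def half_lattice_def)
  \<comment> \<open>The vertical edge rule for the whole column through \<open>z\<close>.\<close>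
  define V where "V z \<longleftrightarrow> (\<forall>n::int. let w = Complex (Re z) (of_int n) in
      F (w + \<i>) = F w + \<i> * (f w + f (w + \<i>)) / 2)" for z
  have "V z" if "z \<in> D" for z
    using D that
  proof (induction rule: lattice_induct)
    case origin
    have "Complex (Re 0) (of_int n) = pt 0 n" for n by (simp add: pt_def)
    then show ?case
      by (simp add: V_def Let_def pt_steps F_pt signed_sum_step ver_def)
  next
    case (right z)
    have transfer: "F (w + \<i>) = F w + \<i> * (f w + f (w + \<i>)) / 2 \<longleftrightarrow>
        F (w + 1 + \<i>) = F (w + 1) + \<i> * (f (w + 1) + f (w + 1 + \<i>)) / 2" if w: "w \<in> D" for w
    proof -
      have sq: "f (w + 1 + \<i>) = f w + \<i> * f (w + 1) - \<i> * f (w + \<i>)"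
        using discrete_analytic_square[OF f w] by (simp add: algebra_simps)
      have e: "w + 1 + \<i> = w + \<i> + 1" by simp
      have F1: "F (w + 1) = F w + (f w + f (w + 1)) / 2"
        by (rule F_right[OF w])
      have F2: "F (w + 1 + \<i>) = F (w + \<i>) + (f (w + \<i>) + f (w + 1 + \<i>)) / 2"
        unfolding e by (rule F_right[OF lattice_domain_facts(3)[OF D w]])
      have "F (w + 1 + \<i>) - (F (w + 1) + \<i> * (f (w + 1) + f (w + 1 + \<i>)) / 2)
          = F (w + \<i>) - (F w + \<i> * (f w + f (w + \<i>)) / 2)"
        unfolding F1 F2 sq by (simp add: field_simps)
      then show ?thesis by (metis right_minus_eq)
    qed
    have e: "Complex (Re z) t + 1 = Complex (Re (z + 1)) t" for t by (simp add: complex_eq_iff)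
    show ?case
      using transfer[OF Re_mem[OF right]] unfolding V_def Let_def e by simp
  next
    case (up z)
    then show ?case by (simp add: V_def)
  qed
  then have "F (z + \<i>) = F z + \<i> * (f z + f (z + \<i>)) / 2" if "z \<in> D" for z
    using that pt_ex[OF that] unfolding V_def Let_def pt_def by (metis complex.sel(1))
  moreover have "F 0 = 0" by (simp add: F_def)
  ultimately show thesis
    using F_right that[of F] by (auto simp: discrete_primitive_def)
qed

text \<open>In the applications \<open>g\<close> is \<open>Z f\<close>. Horizontally \<open>Z\<close> is a right inverse of the difference
  \<open>g (z + 1) - g z\<close>, and this together with the vertical rule determines \<open>Z f\<close> without any reference
  to integrals.\<close>

definition Z_related :: "complex set \<Rightarrow> (complex \<Rightarrow> complex) \<Rightarrow> (complex \<Rightarrow> complex) \<Rightarrow> bool" where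
  "Z_related D f g \<longleftrightarrow> g 0 = 0 \<and>
    (\<forall>z\<in>D. g (z + 1) = g z + f z) \<and>
    (\<forall>z\<in>D. g (z + \<i>) = g z + (1 + \<i>) / 2 * f z + (\<i> - 1) / 2 * f (z + \<i>))"

lemma Z_related_Z_op:
  assumes D: "lattice_domain D" and f: "discrete_analytic_on D f"
  shows "Z_related D f (Z_op D f)"
proof -
  obtain F where F: "discrete_primitive D f F"
    using discrete_primitive_exists[OF D f] .
  have Z: "Z_op D f z = (f 0 - f z) / 2 + F z" if "z \<in> D" for z
    using discrete_integral_primitive[OF D F that] by (simp add: Z_op_def)
  have right: "F (z + 1) = F z + (f z + f (z + 1)) / 2" if "z \<in> D" for z
    using F that by (simp add: discrete_primitive_def)
  have up: "F (z + \<i>) = F z + \<i> * (f z + f (z + \<i>)) / 2" if "z \<in> D" for z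
    using F that by (simp add: discrete_primitive_def)
  have "F 0 = 0" using F by (simp add: discrete_primitive_def)
  then show ?thesis
    using lattice_domain_facts(1-3)[OF D]
    by (auto simp: Z_related_def Z right up) (simp_all add: field_simps)
qed

lemma Z_related_discrete_analytic:
  assumes D: "lattice_domain D" and g: "Z_related D f g"
  shows "discrete_analytic_on D g"
proof (rule discrete_analytic_onI)
  fix z assume z: "z \<in> D"
  then have z': "z + \<i> \<in> D" using lattice_domain_facts(3)[OF D] by simp
  have e: "z + 1 + \<i> = z + \<i> + 1" by simp
  have 1: "g (z + 1) = g z + f z" "g (z + \<i> + 1) = g (z + \<i>) + f (z + \<i>)"
    using g z z' by (simp_all add: Z_related_def)
  have 2: "g (z + \<i>) = g z + (1 + \<i>) / 2 * f z + (\<i> - 1) / 2 * f (z + \<i>)"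
    using g z by (simp add: Z_related_def)
  show "g z + \<i> * g (z + 1) = g (z + 1 + \<i>) + \<i> * g (z + \<i>)"
    unfolding e 1 2 by (simp add: field_simps)
qed

lemma Z_related_unique:
  assumes D: "lattice_domain D" and g: "Z_related D f g" "Z_related D f' g'"
    and f: "\<And>z. z \<in> D \<Longrightarrow> f z = f' z" and z: "z \<in> D"
  shows "g z = g' z"
  using D z
proof (induction rule: lattice_induct)
  case origin
  then show ?case using g by (simp add: Z_related_def)
next
  case (right z)
  then show ?case using g f by (auto simp: Z_related_def)
next
  case (up z)
  then show ?case
    using g f lattice_domain_facts(3)[OF D up] by (auto simp: Z_related_def)
qed

lemma Z_related_subset:
  "Z_related D f g \<Longrightarrow> D' \<subseteq> D \<Longrightarrow> Z_related D' f g"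
  by (auto simp: Z_related_def)

lemma Z_iterate_discrete_analytic:
  assumes "lattice_domain D" "discrete_analytic_on D f"
  shows "discrete_analytic_on D ((Z_op D ^^ n) f)"
proof (induction n)
  case (Suc n)
  show ?case
    using Z_related_discrete_analytic[OF assms(1) Z_related_Z_op[OF assms(1) Suc]] by simp
qed (use assms in simp)

lemma Z_related_iterate:
  assumes "lattice_domain D" "discrete_analytic_on D f"
  shows "Z_related D ((Z_op D ^^ n) f) ((Z_op D ^^ Suc n) f)"
  using Z_related_Z_op[OF assms(1) Z_iterate_discrete_analytic[OF assms]] by simp

section \<open>The discrete powers\<close>

lemma dpow_0 [simp]: "dpow 0 z = 1"
  by (simp add: dpow_def)

lemma dpow_Z_related_full: "Z_related full_lattice (dpow n) (dpow (Suc n))"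
  unfolding dpow_def
  by (rule Z_related_iterate) (auto intro: lattice_domain_full discrete_analytic_onI)

lemma dpow_Z_related: "Z_related half_lattice (dpow n) (dpow (Suc n))"
  using dpow_Z_related_full Z_related_subset lattice_domain_facts(4)[OF lattice_domain_half] by blast

lemma dpow_discrete_analytic: "discrete_analytic_on half_lattice (dpow n)"
proof (cases n)
  case 0
  have "dpow 0 = (\<lambda>_. 1)" by (simp add: dpow_def)
  then show ?thesis using 0 by (auto intro: discrete_analytic_onI)
next
  case (Suc m)
  then show ?thesis
    using Z_related_discrete_analytic[OF lattice_domain_half dpow_Z_related] by blast
qed

lemma dpow_Suc_0 [simp]: "dpow (Suc n) 0 = 0"
  using dpow_Z_related by (simp add: Z_related_def)

lemma dpow_Suc_right: "z \<in> half_lattice \<Longrightarrow> dpow (Suc n) (z + 1) = dpow (Suc n) z + dpow n z"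
  using dpow_Z_related by (simp add: Z_related_def)

lemma dpow_Suc_up:
  "z \<in> half_lattice \<Longrightarrow> dpow (Suc n) (z + \<i>) =
    dpow (Suc n) z + (1 + \<i>) / 2 * dpow n z + (\<i> - 1) / 2 * dpow n (z + \<i>)"
  using dpow_Z_related by (simp add: Z_related_def)

lemma dpow_of_nat: "dpow n (of_nat x) = of_nat (x choose n)"
proof (induction x arbitrary: n)
  case 0
  then show ?case by (cases n) auto
next
  case (Suc x)
  then show ?case
    using dpow_Suc_right[OF nat_in_half_lattice[of x]] by (cases n) (auto simp: add.commute)
qed

text \<open>Summing the recurrence bounds every partial sum \<open>S\<close> by \<open>q * S\<close> plus a constant.\<close>

lemma summable_norm_contracting_recurrence:
  fixes y :: "nat \<Rightarrow> complex" and x :: "nat \<Rightarrow> real"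
  assumes q: "q < 1" and x: "summable x" "\<And>n. 0 \<le> x n"
    and step: "\<And>n. cmod (y (Suc n)) \<le> q * cmod (y n) + x n" and q0: "0 \<le> q"
  shows "summable (\<lambda>n. cmod (y n))"
proof (rule bounded_imp_summable)
  fix N
  define S where "S = (\<Sum>n\<le>N. cmod (y n))"
  have "S \<le> (\<Sum>n\<le>Suc N. cmod (y n))" by (simp add: S_def)
  also have "\<dots> = cmod (y 0) + (\<Sum>n\<le>N. cmod (y (Suc n)))"
    by (rule sum.atMost_Suc_shift)
  also have "(\<Sum>n\<le>N. cmod (y (Suc n))) \<le> (\<Sum>n\<le>N. q * cmod (y n) + x n)"
    by (intro sum_mono step)
  also have "\<dots> = q * S + (\<Sum>n\<le>N. x n)"
    by (simp add: S_def sum.distrib sum_distrib_left)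
  also have "(\<Sum>n\<le>N. x n) \<le> suminf x"
    using x by (intro sum_le_suminf) auto
  finally have "S * (1 - q) \<le> cmod (y 0) + suminf x" by (simp add: algebra_simps)
  then show "(\<Sum>n\<le>N. cmod (y n)) \<le> (cmod (y 0) + suminf x) / (1 - q)"
    using q by (simp add: S_def field_simps)
qed auto

text \<open>For fixed \<open>z\<close> the powers \<open>dpow n z\<close> decay geometrically. Their generating function
  \<open>(1 + t) ^ x * ((2 + (1 + \<i>) * t) / (2 + (1 - \<i>) * t)) powi y\<close>, at \<open>z = x + \<i> * y\<close>, has radius of
  convergence at least \<open>sqrt 2\<close>. It is enough to follow absolute summability along lattice steps: a
  vertical step, upwards or downwards, is a first-order recurrence in \<open>n\<close> with ratio of
  modulus \<open>1 / sqrt 2\<close>.\<close>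

lemma dpow_abs_summable:
  assumes "z \<in> half_lattice"
  shows "summable (\<lambda>n. cmod (dpow n z))"
  using assms
proof (induction rule: half_lattice_induct)
  case origin
  have "summable (\<lambda>n. cmod (dpow (Suc n) 0))" by simp
  then show ?case by (subst (asm) summable_Suc_iff)
next
  case (right z)
  have e: "dpow (Suc n) (z + 1) = dpow (Suc n) z + dpow n z" for n
    by (rule dpow_Suc_right[OF right(1)])
  have "summable (\<lambda>n. cmod (dpow (Suc n) z) + cmod (dpow n z))"
    using right(2) summable_Suc_iff[of "\<lambda>n. cmod (dpow n z)"] by (intro summable_add) auto
  then have "summable (\<lambda>n. cmod (dpow (Suc n) (z + 1)))"
    by (rule summable_comparison_test'[where N = 0]) (auto simp: e norm_triangle_ineq)
  then show ?case by (subst (asm) summable_Suc_iff)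
next
  case (up z)
  define q where "q = cmod ((1 + \<i>) / 2)"
  have q': "cmod ((\<i> - 1) / 2) = q" "0 \<le> q"
    by (auto simp: q_def cmod_def)
  have "q\<^sup>2 = 1 / 2" unfolding q_def cmod_power2 by (simp add: power2_eq_square)
  then have q: "q < 1" using q'(2) by (smt (verit) one_le_power field_sum_of_halves)
  have e: "dpow (Suc n) (z + \<i>) =
    dpow (Suc n) z + (1 + \<i>) / 2 * dpow n z + (\<i> - 1) / 2 * dpow n (z + \<i>)" for n
    by (rule dpow_Suc_up[OF up])
  have b: "cmod (dpow (Suc n) (z + \<i>)) \<le>
      cmod (dpow (Suc n) z) + q * cmod (dpow n z) + q * cmod (dpow n (z + \<i>))" for n
    unfolding e using norm_triangle_ineq[of "dpow (Suc n) z + (1 + \<i>) / 2 * dpow n z"] 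
       norm_triangle_ineq[of "dpow (Suc n) z" "(1 + \<i>) / 2 * dpow n z"] q'
    by (smt (verit) norm_mult q_def)
  have e': "dpow (Suc n) z =
    dpow (Suc n) (z + \<i>) - (1 + \<i>) / 2 * dpow n z - (\<i> - 1) / 2 * dpow n (z + \<i>)" for n
    unfolding e by simp
  have b': "cmod (dpow (Suc n) z) \<le>
      cmod (dpow (Suc n) (z + \<i>)) + q * cmod (dpow n z) + q * cmod (dpow n (z + \<i>))" for n
    unfolding e'[of n] using norm_triangle_ineq4[of "dpow (Suc n) (z + \<i>) - (1 + \<i>) / 2 * dpow n z"] 
       norm_triangle_ineq4[of "dpow (Suc n) (z + \<i>)" "(1 + \<i>) / 2 * dpow n z"] q'
    by (smt (verit) norm_mult q_def)
  have forcing: "summable (\<lambda>n. cmod (dpow (Suc n) w) + q * cmod (dpow n w))"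
    if "summable (\<lambda>n. cmod (dpow n w))" for w
    using that summable_Suc_iff[of "\<lambda>n. cmod (dpow n w)"]
    by (intro summable_add summable_mult) auto
  show ?case
  proof
    assume "summable (\<lambda>n. cmod (dpow n z))"
    from forcing[OF this] show "summable (\<lambda>n. cmod (dpow n (z + \<i>)))"
      by (rule summable_norm_contracting_recurrence[OF q]) (use b q' in \<open>auto simp: algebra_simps\<close>)
  next
    assume "summable (\<lambda>n. cmod (dpow n (z + \<i>)))"
    from forcing[OF this] show "summable (\<lambda>n. cmod (dpow n z))"
      by (rule summable_norm_contracting_recurrence[OF q]) (use b' q' in \<open>auto simp: algebra_simps\<close>)
  qed
qed

section \<open>Contractive Toeplitz matrices\<close>

text \<open>A matrix and its transpose have the same norm. Writing \<open>g\<close> for the transposed matrix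
  applied to \<open>u\<close>, and \<open>h\<close> for the matrix applied to the conjugate of \<open>g\<close>, both \<open>\<Sum>|g|\<^sup>2\<close> and the
  pairing of \<open>u\<close> with \<open>h\<close> are the same double sum. Hence \<open>2 \<Sum>|g|\<^sup>2 \<le> \<Sum>|u|\<^sup>2 + \<Sum>|h|\<^sup>2\<close>, and the
  hypothesis gives \<open>\<Sum>|h|\<^sup>2 \<le> \<Sum>|g|\<^sup>2\<close>.\<close>

lemma contractive_matrix_transpose:
  fixes A :: "'i \<Rightarrow> 'j \<Rightarrow> complex"
  assumes A: "\<And>f. (\<Sum>i\<in>I. (cmod (\<Sum>j\<in>J. A i j * f j))\<^sup>2) \<le> (\<Sum>j\<in>J. (cmod (f j))\<^sup>2)"
  shows "(\<Sum>j\<in>J. (cmod (\<Sum>i\<in>I. A i j * u i))\<^sup>2) \<le> (\<Sum>i\<in>I. (cmod (u i))\<^sup>2)"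
proof -
  define g where "g j = (\<Sum>i\<in>I. A i j * u i)" for j
  define h where "h i = (\<Sum>j\<in>J. A i j * cnj (g j))" for i
  define S where "S = (\<Sum>j\<in>J. (cmod (g j))\<^sup>2)"
  have "complex_of_real S = (\<Sum>j\<in>J. cnj (g j) * (\<Sum>i\<in>I. A i j * u i))"
    unfolding S_def of_real_sum complex_norm_square by (simp add: g_def mult.commute)
  also have "\<dots> = (\<Sum>j\<in>J. \<Sum>i\<in>I. cnj (g j) * (A i j * u i))"
    by (simp add: sum_distrib_left)
  also have "\<dots> = (\<Sum>i\<in>I. \<Sum>j\<in>J. cnj (g j) * (A i j * u i))"
    by (rule sum.swap)
  also have "\<dots> = (\<Sum>i\<in>I. u i * h i)"
    by (simp add: h_def sum_distrib_left mult_ac)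
  finally have "S \<le> cmod (\<Sum>i\<in>I. u i * h i)"
    by (metis Re_complex_of_real complex_Re_le_cmod)
  also have "\<dots> \<le> (\<Sum>i\<in>I. cmod (u i) * cmod (h i))"
    by (rule order_trans[OF norm_sum]) (simp add: norm_mult)
  also have "\<dots> \<le> (\<Sum>i\<in>I. ((cmod (u i))\<^sup>2 + (cmod (h i))\<^sup>2) / 2)"
  proof (rule sum_mono)
    fix i
    show "cmod (u i) * cmod (h i) \<le> ((cmod (u i))\<^sup>2 + (cmod (h i))\<^sup>2) / 2"
      using sum_squares_bound[of "cmod (u i)" "cmod (h i)"] by simp
  qed
  also have "\<dots> = ((\<Sum>i\<in>I. (cmod (u i))\<^sup>2) + (\<Sum>i\<in>I. (cmod (h i))\<^sup>2)) / 2"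
    by (simp add: sum.distrib flip: sum_divide_distrib)
  finally have "2 * S \<le> (\<Sum>i\<in>I. (cmod (u i))\<^sup>2) + (\<Sum>i\<in>I. (cmod (h i))\<^sup>2)" by simp
  moreover have "(\<Sum>i\<in>I. (cmod (h i))\<^sup>2) \<le> S"
    using A[of "\<lambda>j. cnj (g j)"] by (simp add: h_def S_def)
  ultimately show ?thesis by (simp add: S_def g_def)
qed

definition toeplitz :: "(nat \<Rightarrow> complex) \<Rightarrow> nat \<Rightarrow> nat \<Rightarrow> complex" where
  "toeplitz t k n = (if n \<le> k then t (k - n) else 0)"

text \<open>The lower triangular Toeplitz matrix with symbol \<open>t\<close> is a contraction. Since the matrix is
  triangular it suffices to speak about its finite sections.\<close>

definition toeplitz_contractive :: "(nat \<Rightarrow> complex) \<Rightarrow> bool" where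
  "toeplitz_contractive t \<longleftrightarrow>
    (\<forall>N f. (\<Sum>k<N. (cmod (\<Sum>m\<le>k. t m * f (k - m)))\<^sup>2) \<le> (\<Sum>k<N. (cmod (f k))\<^sup>2))"

lemma toeplitz_apply:
  assumes "k < N"
  shows "(\<Sum>n<N. toeplitz t k n * f n) = (\<Sum>m\<le>k. t m * f (k - m))"
proof -
  have "(\<Sum>n<N. toeplitz t k n * f n) = (\<Sum>n\<le>k. t (k - n) * f n)"
    by (rule sum.mono_neutral_cong_right) (use assms in \<open>auto simp: toeplitz_def\<close>)
  also have "\<dots> = (\<Sum>m\<le>k. t m * f (k - m))"
    by (rule sum.reindex_bij_witness[where i = "\<lambda>m. k - m" and j = "\<lambda>m. k - m"]) auto
  finally show ?thesis .
qed

lemma toeplitz_contractive_iff_transpose: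
  "toeplitz_contractive t \<longleftrightarrow>
    (\<forall>N u. (\<Sum>n<N. (cmod (\<Sum>k<N. toeplitz t k n * u k))\<^sup>2) \<le> (\<Sum>k<N. (cmod (u k))\<^sup>2))"
proof -
  have "toeplitz_contractive t \<longleftrightarrow>
    (\<forall>N f. (\<Sum>k<N. (cmod (\<Sum>n<N. toeplitz t k n * f n))\<^sup>2) \<le> (\<Sum>k<N. (cmod (f k))\<^sup>2))"
    by (simp add: toeplitz_contractive_def toeplitz_apply)
  also have "\<dots> \<longleftrightarrow> 
    (\<forall>N u. (\<Sum>n<N. (cmod (\<Sum>k<N. toeplitz t k n * u k))\<^sup>2) \<le> (\<Sum>k<N. (cmod (u k))\<^sup>2))"
  proof (rule iff_allI, intro iffI allI)
    fix N u
    assume A: "\<forall>f. (\<Sum>k<N. (cmod (\<Sum>n<N. toeplitz t k n * f n))\<^sup>2) \<le> (\<Sum>k<N. (cmod (f k))\<^sup>2)"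
    show "(\<Sum>n<N. (cmod (\<Sum>k<N. toeplitz t k n * u k))\<^sup>2) \<le> (\<Sum>k<N. (cmod (u k))\<^sup>2)"
      by (rule contractive_matrix_transpose) (rule A[rule_format])
  next
    fix N f
    assume A: "\<forall>u. (\<Sum>n<N. (cmod (\<Sum>k<N. toeplitz t k n * u k))\<^sup>2) \<le> (\<Sum>k<N. (cmod (u k))\<^sup>2)"
    show "(\<Sum>k<N. (cmod (\<Sum>n<N. toeplitz t k n * f n))\<^sup>2) \<le> (\<Sum>k<N. (cmod (f k))\<^sup>2)"
      by (rule contractive_matrix_transpose) (rule A[rule_format])
  qed
  finally show ?thesis .
qed

lemma summable_suminf_le_bounded_sums:
  fixes f :: "nat \<Rightarrow> real"
  assumes "\<And>n. 0 \<le> f n" "\<And>N. (\<Sum>n<N. f n) \<le> B"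
  shows "summable f" "suminf f \<le> B"
proof -
  show "summable f"
    using assms by (rule summableI_nonneg_bounded)
  then show "suminf f \<le> B"
    using assms(2) by (rule suminf_le_const)
qed

lemma toeplitz_contractive_conv:
  assumes t: "toeplitz_contractive t" and f: "summable (\<lambda>n. (cmod (f n))\<^sup>2)"
  shows "summable (\<lambda>n. (cmod (\<Sum>m\<le>n. t m * f (n - m)))\<^sup>2)"
    and "(\<Sum>n. (cmod (\<Sum>m\<le>n. t m * f (n - m)))\<^sup>2) \<le> (\<Sum>n. (cmod (f n))\<^sup>2)"
proof -
  have b: "(\<Sum>n<N. (cmod (\<Sum>m\<le>n. t m * f (n - m)))\<^sup>2) \<le> (\<Sum>n. (cmod (f n))\<^sup>2)" for N
  proof -
    have "(\<Sum>n<N. (cmod (\<Sum>m\<le>n. t m * f (n - m)))\<^sup>2) \<le> (\<Sum>n<N. (cmod (f n))\<^sup>2)"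
      using t by (simp add: toeplitz_contractive_def)
    also have "\<dots> \<le> (\<Sum>n. (cmod (f n))\<^sup>2)"
      using f by (intro sum_le_suminf) auto
    finally show ?thesis .
  qed
  show "summable (\<lambda>n. (cmod (\<Sum>m\<le>n. t m * f (n - m)))\<^sup>2)"
    "(\<Sum>n. (cmod (\<Sum>m\<le>n. t m * f (n - m)))\<^sup>2) \<le> (\<Sum>n. (cmod (f n))\<^sup>2)"
    using summable_suminf_le_bounded_sums[OF _ b] by auto
qed

text \<open>The symbol is the first column of the matrix.\<close>

lemma toeplitz_contractive_square_summable:
  assumes t: "toeplitz_contractive t"
  shows "summable (\<lambda>n. (cmod (t n))\<^sup>2)"
proof -
  define e where "e n = (if n = 0 then 1 else 0 :: complex)" for n :: nat
  have "(\<Sum>m\<le>n. t m * e (n - m)) = t n" for n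
  proof -
    have "(\<Sum>m\<le>n. t m * e (n - m)) = (\<Sum>m\<le>n. if m = n then t m else 0)"
      by (intro sum.cong) (auto simp: e_def)
    then show ?thesis by simp
  qed
  moreover have "summable (\<lambda>n. (cmod (e n))\<^sup>2)"
    by (rule summable_finite[of "{0}"]) (auto simp: e_def)
  ultimately show ?thesis
    using toeplitz_contractive_conv(1)[OF t, of e] by simp
qed

lemma square_summable_bounded:
  assumes "summable (\<lambda>n. (cmod (c n))\<^sup>2)"
  obtains B where "\<And>n. cmod (c n) \<le> B"
proof -
  have "(cmod (c n))\<^sup>2 \<le> (\<Sum>n. (cmod (c n))\<^sup>2)" for n
    using sum_le_suminf[OF assms, of "{n}"] by simp
  then have "cmod (c n) \<le> sqrt (\<Sum>n. (cmod (c n))\<^sup>2)" for n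
    by (rule real_le_rsqrt)
  then show thesis using that by blast
qed

lemma summable_bounded_mult:
  fixes c v :: "nat \<Rightarrow> complex"
  assumes "\<And>n. cmod (c n) \<le> B" "summable (\<lambda>n. cmod (v n))"
  shows "summable (\<lambda>n. cmod (c n * v n))"
proof (rule summable_comparison_test'[where N = 0])
  show "summable (\<lambda>n. B * cmod (v n))" using assms(2) by (rule summable_mult)
qed (use assms(1) in \<open>auto simp: norm_mult intro!: mult_right_mono\<close>)

lemma abs_summable_square_summable:
  fixes v :: "nat \<Rightarrow> complex"
  assumes "summable (\<lambda>n. cmod (v n))"
  shows "summable (\<lambda>n. (cmod (v n))\<^sup>2)"
proof -
  have "cmod (v n) \<le> (\<Sum>n. cmod (v n))" for n
    using sum_le_suminf[OF assms, of "{n}"] by simp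
  from summable_bounded_mult[OF this assms] show ?thesis
    by (simp add: norm_mult power2_eq_square)
qed

text \<open>The bound passes from finite sections to the limit. Every row converges because \<open>t\<close> is bounded
  and \<open>u\<close> is absolutely summable.\<close>

lemma toeplitz_contractive_transpose:
  assumes t: "toeplitz_contractive t" and u: "summable (\<lambda>n. cmod (u n))"
  shows "summable (\<lambda>n. (cmod (\<Sum>m. t m * u (m + n)))\<^sup>2)"
    and "(\<Sum>n. (cmod (\<Sum>m. t m * u (m + n)))\<^sup>2) \<le> (\<Sum>n. (cmod (u n))\<^sup>2)"
proof -
  obtain B where B: "\<And>n. cmod (t n) \<le> B"
    using square_summable_bounded[OF toeplitz_contractive_square_summable[OF t]] by blast
  have row: "(\<lambda>k. toeplitz t k n * u k) sums (\<Sum>m. t m * u (m + n))" for n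
  proof -
    have "summable (\<lambda>m. cmod (u (m + n)))"
      using u summable_iff_shift[of "\<lambda>n. cmod (u n)"] by simp
    from summable_bounded_mult[OF B this]
    have "(\<lambda>m. t m * u (m + n)) sums (\<Sum>m. t m * u (m + n))"
      by (rule summable_sums[OF summable_norm_cancel])
    then have "(\<lambda>m. toeplitz t (m + n) n * u (m + n)) sums (\<Sum>m. t m * u (m + n))"
      by (simp add: toeplitz_def)
    then show ?thesis
      by (subst (asm) sums_zero_iff_shift) (auto simp: toeplitz_def)
  qed
  have b: "(\<Sum>n<M. (cmod (\<Sum>m. t m * u (m + n)))\<^sup>2) \<le> (\<Sum>n. (cmod (u n))\<^sup>2)" for M
  proof (rule LIMSEQ_le_const2)
    show "(\<lambda>N. \<Sum>n<M. (cmod (\<Sum>k<N. toeplitz t k n * u k))\<^sup>2)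
        \<longlonglongrightarrow> (\<Sum>n<M. (cmod (\<Sum>m. t m * u (m + n)))\<^sup>2)"
      using row unfolding sums_def by (intro tendsto_intros) auto
    show "\<exists>N0. \<forall>N\<ge>N0. (\<Sum>n<M. (cmod (\<Sum>k<N. toeplitz t k n * u k))\<^sup>2) \<le> (\<Sum>n. (cmod (u n))\<^sup>2)"
    proof (intro exI allI impI)
      fix N assume "M \<le> N"
      then have "(\<Sum>n<M. (cmod (\<Sum>k<N. toeplitz t k n * u k))\<^sup>2)
          \<le> (\<Sum>n<N. (cmod (\<Sum>k<N. toeplitz t k n * u k))\<^sup>2)"
        by (intro sum_mono2) auto
      also have "\<dots> \<le> (\<Sum>n<N. (cmod (u n))\<^sup>2)"
        using t toeplitz_contractive_iff_transpose by blast
      also have "\<dots> \<le> (\<Sum>n. (cmod (u n))\<^sup>2)"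
        by (intro sum_le_suminf abs_summable_square_summable[OF u]) auto
      finally show "(\<Sum>n<M. (cmod (\<Sum>k<N. toeplitz t k n * u k))\<^sup>2) \<le> (\<Sum>n. (cmod (u n))\<^sup>2)" .
    qed
  qed
  show "summable (\<lambda>n. (cmod (\<Sum>m. t m * u (m + n)))\<^sup>2)"
    "(\<Sum>n. (cmod (\<Sum>m. t m * u (m + n)))\<^sup>2) \<le> (\<Sum>n. (cmod (u n))\<^sup>2)"
    using summable_suminf_le_bounded_sums[OF _ b] by auto
qed

lemma summable_cnj_mult:
  fixes u v :: "nat \<Rightarrow> complex"
  assumes "summable (\<lambda>n. (cmod (u n))\<^sup>2)" "summable (\<lambda>n. (cmod (v n))\<^sup>2)"
  shows "summable (\<lambda>n. u n * cnj (v n))"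
proof (rule summable_comparison_test'[where N = 0])
  show "summable (\<lambda>n. (cmod (u n))\<^sup>2 + (cmod (v n))\<^sup>2)" using assms by (rule summable_add)
  fix n
  show "norm (u n * cnj (v n)) \<le> (cmod (u n))\<^sup>2 + (cmod (v n))\<^sup>2"
    using sum_squares_bound[of "cmod (u n)" "cmod (v n)"]
      mult_nonneg_nonneg[OF norm_ge_zero norm_ge_zero, of "u n" "v n"]
    unfolding norm_mult complex_mod_cnj mult.assoc by linarith
qed

lemma sums_square_norm_combination:
  fixes v :: "'j \<Rightarrow> nat \<Rightarrow> complex"
  assumes v: "\<And>j. j \<in> J \<Longrightarrow> summable (\<lambda>n. (cmod (v j n))\<^sup>2)"
  shows "(\<lambda>n. complex_of_real ((cmod (\<Sum>j\<in>J. c j * v j n))\<^sup>2)) sums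
    (\<Sum>j\<in>J. \<Sum>k\<in>J. c j * cnj (c k) * (\<Sum>n. v j n * cnj (v k n)))"
proof -
  have e: "complex_of_real ((cmod (\<Sum>j\<in>J. c j * v j n))\<^sup>2) =
      (\<Sum>j\<in>J. \<Sum>k\<in>J. c j * cnj (c k) * (v j n * cnj (v k n)))" for n
    unfolding complex_norm_square by (simp add: cnj_sum sum_product mult_ac)
  show ?thesis
    unfolding e by (intro sums_sum sums_mult summable_sums summable_cnj_mult v)
qed

text \<open>Positivity of a difference of two Gram kernels says that the passage from combinations of
  the first family to those of the second decreases the norm.\<close>

lemma gram_difference_positive_iff:
  fixes v \<sigma> :: "'j \<Rightarrow> nat \<Rightarrow> complex"
  assumes v: "\<And>j. j \<in> J \<Longrightarrow> summable (\<lambda>n. (cmod (v j n))\<^sup>2)"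
    and \<sigma>: "\<And>j. j \<in> J \<Longrightarrow> summable (\<lambda>n. (cmod (\<sigma> j n))\<^sup>2)"
  shows "(\<Sum>j\<in>J. \<Sum>k\<in>J. c j * cnj (c k) * (\<Sum>n. v j n * cnj (v k n) - \<sigma> j n * cnj (\<sigma> k n))) \<in> \<real>\<^sub>\<ge>\<^sub>0
    \<longleftrightarrow> (\<Sum>n. (cmod (\<Sum>j\<in>J. c j * \<sigma> j n))\<^sup>2) \<le> (\<Sum>n. (cmod (\<Sum>j\<in>J. c j * v j n))\<^sup>2)"
proof -
  have s: "summable (\<lambda>n. (cmod (\<Sum>j\<in>J. c j * w j n))\<^sup>2) \<and>
     (\<Sum>j\<in>J. \<Sum>k\<in>J. c j * cnj (c k) * (\<Sum>n. w j n * cnj (w k n))) =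
     complex_of_real (\<Sum>n. (cmod (\<Sum>j\<in>J. c j * w j n))\<^sup>2)"
    if w: "\<And>j. j \<in> J \<Longrightarrow> summable (\<lambda>n. (cmod (w j n))\<^sup>2)" for w
  proof -
    have "summable (\<lambda>n. (cmod (\<Sum>j\<in>J. c j * w j n))\<^sup>2)"
      using sums_summable[OF sums_square_norm_combination[of J w c, OF w]]
      unfolding summable_of_real_iff .
    moreover have "(\<lambda>n. complex_of_real ((cmod (\<Sum>j\<in>J. c j * w j n))\<^sup>2)) sums
      complex_of_real (\<Sum>n. (cmod (\<Sum>j\<in>J. c j * w j n))\<^sup>2)"
      by (rule sums_of_real) (rule summable_sums, fact)
    ultimately show ?thesis
      using sums_unique2[OF sums_square_norm_combination[of J w c, OF w]] by blast
  qed
  have "(\<Sum>j\<in>J. \<Sum>k\<in>J. c j * cnj (c k) * (\<Sum>n. v j n * cnj (v k n) - \<sigma> j n * cnj (\<sigma> k n))) =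
     (\<Sum>j\<in>J. \<Sum>k\<in>J. c j * cnj (c k) * ((\<Sum>n. v j n * cnj (v k n)) - (\<Sum>n. \<sigma> j n * cnj (\<sigma> k n))))"
    by (intro sum.cong refl arg_cong2[where f = "(*)"] suminf_diff[symmetric] summable_cnj_mult v \<sigma>)
  also have "\<dots> = complex_of_real ((\<Sum>n. (cmod (\<Sum>j\<in>J. c j * v j n))\<^sup>2) -
     (\<Sum>n. (cmod (\<Sum>j\<in>J. c j * \<sigma> j n))\<^sup>2))"
    using s[of v] s[of \<sigma>] v \<sigma> by (simp add: right_diff_distrib sum_subtractf)
  finally show ?thesis by (simp only: nonneg_Reals_of_real_iff diff_ge_0_iff_ge)
qed


section \<open>Coefficients and the Hardy space\<close>

lemma dpow_series_at_nat:
  "(\<lambda>n. c n * dpow n (of_nat x)) sums (\<Sum>n\<le>x. c n * of_nat (x choose n))"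
proof -
  have "(\<lambda>n. c n * dpow n (of_nat x)) sums (\<Sum>n\<le>x. c n * dpow n (of_nat x))"
    by (rule sums_finite) (auto simp: dpow_of_nat binomial_eq_0)
  then show ?thesis by (simp add: dpow_of_nat)
qed

text \<open>On the nonnegative integers a series in the powers is a Newton series, hence a finite
  triangular system for its coefficients; this gives uniqueness without any growth condition.\<close>

lemma newton_coefficients_unique:
  fixes c c' :: "nat \<Rightarrow> complex"
  assumes "\<And>x. (\<Sum>n\<le>x. c n * of_nat (x choose n)) = (\<Sum>n\<le>x. c' n * of_nat (x choose n))"
  shows "c = c'"
proof
  fix x
  show "c x = c' x"
  proof (induction x rule: less_induct)
    case (less x)
    have "(\<Sum>n<x. c n * of_nat (x choose n)) = (\<Sum>n<x. c' n * of_nat (x choose n))"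
      using less by (intro sum.cong) auto
    then show ?case
      using assms[of x] by (simp add: lessThan_Suc_atMost[symmetric])
  qed
qed

text \<open>The coefficients are the iterated forward differences at \<open>0\<close> (Newton interpolation).\<close>

lemma newton_coefficients_exist:
  fixes h :: "nat \<Rightarrow> complex"
  obtains c where "\<And>x. h x = (\<Sum>n\<le>x. c n * of_nat (x choose n))"
proof -
  define \<Delta> where "\<Delta> h = (\<lambda>x. h (Suc x) - h x)" for h :: "nat \<Rightarrow> complex"
  have "h x = (\<Sum>n\<le>x. (\<Delta> ^^ n) h 0 * of_nat (x choose n))" for x and h :: "nat \<Rightarrow> complex"
  proof (induction x arbitrary: h)
    case (Suc x)
    have "(\<Sum>n\<le>Suc x. (\<Delta> ^^ n) h 0 * of_nat (Suc x choose n)) =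
      h 0 + (\<Sum>n\<le>x. (\<Delta> ^^ Suc n) h 0 * of_nat (x choose n)) +
      (\<Sum>n\<le>x. (\<Delta> ^^ Suc n) h 0 * of_nat (x choose Suc n))"
      by (subst sum.atMost_Suc_shift) (simp add: sum.distrib algebra_simps)
    also have "(\<Sum>n\<le>x. (\<Delta> ^^ Suc n) h 0 * of_nat (x choose n)) = \<Delta> h x"
      using Suc[of "\<Delta> h"] by (simp add: funpow_swap1)
    also have "(\<Sum>n\<le>x. (\<Delta> ^^ Suc n) h 0 * of_nat (x choose Suc n)) =
        (\<Sum>n\<le>Suc x. (\<Delta> ^^ n) h 0 * of_nat (x choose n)) - h 0"
      by (subst sum.atMost_Suc_shift) simp
    also have "\<dots> = h x - h 0" using Suc[of h] by simp
    finally show ?case by (simp add: \<Delta>_def)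
  qed simp
  then show thesis by (rule that[of "\<lambda>n. (\<Delta> ^^ n) h 0"])
qed

lemma dpow_series_coefficients_unique:
  assumes "\<And>z. z \<in> half_lattice \<Longrightarrow> (\<lambda>n. c n * dpow n z) sums f z"
    and "\<And>z. z \<in> half_lattice \<Longrightarrow> (\<lambda>n. c' n * dpow n z) sums f z"
  shows "c = c'"
proof (rule newton_coefficients_unique)
  fix x
  show "(\<Sum>n\<le>x. c n * of_nat (x choose n)) = (\<Sum>n\<le>x. c' n * of_nat (x choose n))"
    using sums_unique2[OF assms(1)[OF nat_in_half_lattice] dpow_series_at_nat]
      sums_unique2[OF assms(2)[OF nat_in_half_lattice] dpow_series_at_nat] by metis
qed

lemma dpow_series_abs_summable:
  assumes "summable (\<lambda>n. (cmod (c n))\<^sup>2)" "z \<in> half_lattice"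
  shows "summable (\<lambda>n. cmod (c n * dpow n z))"
proof -
  obtain B where "\<And>n. cmod (c n) \<le> B"
    using square_summable_bounded[OF assms(1)] by blast
  then show ?thesis
    by (rule summable_bounded_mult[OF _ dpow_abs_summable[OF assms(2)]])
qed

lemma dpow_series_sums:
  assumes "summable (\<lambda>n. (cmod (c n))\<^sup>2)" "z \<in> half_lattice"
  shows "(\<lambda>n. c n * dpow n z) sums (\<Sum>n. c n * dpow n z)"
  by (rule summable_sums[OF summable_norm_cancel[OF dpow_series_abs_summable[OF assms]]])

text \<open>Square summable coefficients tend to \<open>0\<close>, so the limit superior of their roots is at most \<open>1\<close>,
  below the required \<open>sqrt 2\<close>.\<close>

lemma dcoeff_eqI:
  assumes c: "summable (\<lambda>n. (cmod (c n))\<^sup>2)"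
    and f: "\<And>z. z \<in> half_lattice \<Longrightarrow> (\<lambda>n. c n * dpow n z) sums f z"
  shows "dcoeff f = c"
  unfolding dcoeff_def
proof (rule the_equality)
  have "(\<lambda>n. (cmod (c n))\<^sup>2) \<longlonglongrightarrow> 0" by (rule summable_LIMSEQ_zero[OF c])
  then have "\<forall>\<^sub>F n in sequentially. (cmod (c n))\<^sup>2 < 1"
    by (rule order_tendstoD) simp
  then have "\<forall>\<^sub>F n in sequentially. ereal (root n (cmod (c n))) \<le> ereal 1"
  proof eventually_elim
    case (elim n)
    then have "cmod (c n) \<le> 1" using abs_square_less_1[of "cmod (c n)"] by simp
    then show ?case by (cases "n = 0") auto
  qed
  then have "limsup (\<lambda>n. ereal (root n (cmod (c n)))) \<le> ereal 1"
    by (rule Limsup_bounded)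
  also have "\<dots> < ereal (sqrt 2)" by simp
  finally show "limsup (\<lambda>n. ereal (root n (cmod (c n)))) < ereal (sqrt 2) \<and>
      (\<forall>z\<in>half_lattice. (\<lambda>n. c n * dpow n z) sums f z)"
    using f by blast
  show "c' = c" if "limsup (\<lambda>n. ereal (root n (cmod (c' n)))) < ereal (sqrt 2) \<and>
      (\<forall>z\<in>half_lattice. (\<lambda>n. c' n * dpow n z) sums f z)" for c'
    using that f by (intro dpow_series_coefficients_unique) auto
qed

lemma hardy_spaceI:
  assumes "summable (\<lambda>n. (cmod (c n))\<^sup>2)"
    and "\<And>z. z \<in> half_lattice \<Longrightarrow> (\<lambda>n. c n * dpow n z) sums f z"
  shows "f \<in> hardy_space"
  using assms by (auto simp: hardy_space_def)

lemma hardy_space_dcoeff: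
  assumes "f \<in> hardy_space"
  shows "summable (\<lambda>n. (cmod (dcoeff f n))\<^sup>2)"
    and "\<And>z. z \<in> half_lattice \<Longrightarrow> (\<lambda>n. dcoeff f n * dpow n z) sums f z"
proof -
  obtain c where c: "summable (\<lambda>n. (cmod (c n))\<^sup>2)"
    "\<And>z. z \<in> half_lattice \<Longrightarrow> (\<lambda>n. c n * dpow n z) sums f z"
    using assms by (auto simp: hardy_space_def)
  then have "dcoeff f = c" by (rule dcoeff_eqI)
  then show "summable (\<lambda>n. (cmod (dcoeff f n))\<^sup>2)"
    "\<And>z. z \<in> half_lattice \<Longrightarrow> (\<lambda>n. dcoeff f n * dpow n z) sums f z"
    using c by auto
qed

lemma hardy_norm_eq:
  assumes "f \<in> hardy_space"
  shows "hardy_norm f = sqrt (\<Sum>n. (cmod (dcoeff f n))\<^sup>2)"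
proof -
  have "(\<lambda>n. complex_of_real ((cmod (dcoeff f n))\<^sup>2)) sums
      complex_of_real (\<Sum>n. (cmod (dcoeff f n))\<^sup>2)"
    by (intro sums_of_real summable_sums hardy_space_dcoeff[OF assms])
  then have "hardy_inner f f = complex_of_real (\<Sum>n. (cmod (dcoeff f n))\<^sup>2)"
    unfolding hardy_inner_def complex_norm_square by (rule sums_unique[symmetric])
  then show ?thesis by (simp add: hardy_norm_def)
qed

lemma dpow_series_discrete_analytic:
  assumes f: "\<And>z. z \<in> half_lattice \<Longrightarrow> (\<lambda>n. c n * dpow n z) sums f z"
  shows "discrete_analytic_on half_lattice f"
proof (rule discrete_analytic_onI)
  fix z assume z: "z \<in> half_lattice"
  note mem = lattice_domain_facts(2,3)[OF lattice_domain_half]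
  have "(\<lambda>n. c n * dpow n z + \<i> * (c n * dpow n (z + 1))) sums (f z + \<i> * f (z + 1))"
    by (intro sums_add sums_mult f mem z)
  moreover have "(\<lambda>n. c n * dpow n (z + 1 + \<i>) + \<i> * (c n * dpow n (z + \<i>))) sums
      (f (z + 1 + \<i>) + \<i> * f (z + \<i>))"
    by (intro sums_add sums_mult f mem z)
  moreover have "c n * dpow n z + \<i> * (c n * dpow n (z + 1)) =
      c n * dpow n (z + 1 + \<i>) + \<i> * (c n * dpow n (z + \<i>))" for n
  proof -
    have "c n * (dpow n z + \<i> * dpow n (z + 1)) = c n * (dpow n (z + 1 + \<i>) + \<i> * dpow n (z + \<i>))"
      using discrete_analytic_square[OF dpow_discrete_analytic z] by simp
    then show ?thesis by (simp add: algebra_simps)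
  qed
  ultimately show "f z + \<i> * f (z + 1) = f (z + 1 + \<i>) + \<i> * f (z + \<i>)"
    using sums_unique2 by simp
qed

section \<open>Multipliers of the Hardy space\<close>

lemma conv_prod_toeplitz_contractive:
  assumes s: "toeplitz_contractive (dcoeff s)" and f: "f \<in> hardy_space"
  shows "summable (\<lambda>n. (cmod (conv_coeff s f n))\<^sup>2)"
    and "(\<Sum>n. (cmod (conv_coeff s f n))\<^sup>2) \<le> (\<Sum>n. (cmod (dcoeff f n))\<^sup>2)"
    and "\<And>z. z \<in> half_lattice \<Longrightarrow> (\<lambda>n. conv_coeff s f n * dpow n z) sums conv_prod s f z"
    and "conv_prod s f \<in> hardy_space" and "dcoeff (conv_prod s f) = conv_coeff s f"
proof -
  show c: "summable (\<lambda>n. (cmod (conv_coeff s f n))\<^sup>2)"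
    "(\<Sum>n. (cmod (conv_coeff s f n))\<^sup>2) \<le> (\<Sum>n. (cmod (dcoeff f n))\<^sup>2)"
    using toeplitz_contractive_conv[OF s hardy_space_dcoeff(1)[OF f]]
    by (auto simp: conv_coeff_def)
  show d: "(\<lambda>n. conv_coeff s f n * dpow n z) sums conv_prod s f z" if "z \<in> half_lattice" for z
    using dpow_series_sums[OF c(1) that] by (simp add: conv_prod_def)
  show "conv_prod s f \<in> hardy_space" "dcoeff (conv_prod s f) = conv_coeff s f"
    using hardy_spaceI[OF c(1) d] dcoeff_eqI[OF c(1) d] by auto
qed

lemma dcoeff_linear:
  assumes f: "f \<in> hardy_space" and g: "g \<in> hardy_space"
  shows "dcoeff (\<lambda>w. a * f w + b * g w) = (\<lambda>n. a * dcoeff f n + b * dcoeff g n)"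
proof (rule dcoeff_eqI)
  define w where "w j = (if j then dcoeff f else dcoeff g)" for j
  have "summable (\<lambda>n. (cmod (w j n))\<^sup>2)" for j
    using hardy_space_dcoeff(1) f g by (simp add: w_def)
  from sums_summable[OF sums_square_norm_combination[of UNIV w "\<lambda>j. if j then a else b", OF this]]
  show "summable (\<lambda>n. (cmod (a * dcoeff f n + b * dcoeff g n))\<^sup>2)"
    unfolding summable_of_real_iff by (simp add: UNIV_bool w_def add.commute)
  fix z assume z: "z \<in> half_lattice"
  have "(\<lambda>n. a * (dcoeff f n * dpow n z) + b * (dcoeff g n * dpow n z)) sums (a * f z + b * g z)"
    by (intro sums_add sums_mult hardy_space_dcoeff(2) f g z)
  then show "(\<lambda>n. (a * dcoeff f n + b * dcoeff g n) * dpow n z) sums (a * f z + b * g z)"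
    by (simp add: algebra_simps)
qed

text \<open>In the coordinates given by the coefficients, multiplication by \<open>s\<close> is the lower triangular
  Toeplitz matrix of \<open>dcoeff s\<close>.\<close>

lemma hardy_contraction_iff_toeplitz:
  "hardy_contraction (\<lambda>f. conv_prod s f) \<longleftrightarrow> toeplitz_contractive (dcoeff s)"
proof
  assume T: "toeplitz_contractive (dcoeff s)"
  note P = conv_prod_toeplitz_contractive[OF T]
  show "hardy_contraction (\<lambda>f. conv_prod s f)"
    unfolding hardy_contraction_def
  proof (intro conjI ballI allI)
    fix f assume f: "f \<in> hardy_space"
    show "conv_prod s f \<in> hardy_space" by (rule P(4)[OF f])
    show "hardy_norm (conv_prod s f) \<le> hardy_norm f"
      using P(2)[OF f] by (simp add: hardy_norm_eq f P(4,5))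
  next
    fix f g a b z assume f: "f \<in> hardy_space" and g: "g \<in> hardy_space" and z: "z \<in> half_lattice"
    have "conv_coeff s (\<lambda>w. a * f w + b * g w) n = a * conv_coeff s f n + b * conv_coeff s g n" for n
      unfolding conv_coeff_def dcoeff_linear[OF f g]
      by (simp add: algebra_simps sum.distrib sum_distrib_left)
    moreover have "(\<lambda>n. a * (conv_coeff s f n * dpow n z) + b * (conv_coeff s g n * dpow n z)) sums
        (a * conv_prod s f z + b * conv_prod s g z)"
      by (intro sums_add sums_mult P(3) f g z)
    ultimately have "(\<lambda>n. conv_coeff s (\<lambda>w. a * f w + b * g w) n * dpow n z) sums
        (a * conv_prod s f z + b * conv_prod s g z)"
      by (simp add: algebra_simps)
    then show "conv_prod s (\<lambda>w. a * f w + b * g w) z = a * conv_prod s f z + b * conv_prod s g z"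
      unfolding conv_prod_def by (rule sums_unique[symmetric])
  qed
next
  assume H: "hardy_contraction (\<lambda>f. conv_prod s f)"
  show "toeplitz_contractive (dcoeff s)"
    unfolding toeplitz_contractive_def
  proof (intro allI)
    fix N and f :: "nat \<Rightarrow> complex"
    define c where "c n = (if n < N then f n else 0)" for n
    define F where "F z = (\<Sum>n. c n * dpow n z)" for z
    have c: "summable (\<lambda>n. (cmod (c n))\<^sup>2)"
      by (rule summable_finite[of "{..<N}"]) (auto simp: c_def)
    have F_sums: "(\<lambda>n. c n * dpow n z) sums F z" if "z \<in> half_lattice" for z
      using dpow_series_sums[OF c that] by (simp add: F_def)
    have F: "F \<in> hardy_space" "dcoeff F = c"
      using hardy_spaceI[OF c F_sums] dcoeff_eqI[OF c F_sums] by auto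
    have sF: "conv_prod s F \<in> hardy_space" and norm: "hardy_norm (conv_prod s F) \<le> hardy_norm F"
      using H F(1) by (auto simp: hardy_contraction_def)
    \<comment> \<open>Convergence of the product series off the real axis is not known here, but at the
      nonnegative integers it is a finite sum, and these values determine the coefficients.\<close>
    have d: "dcoeff (conv_prod s F) = conv_coeff s F"
    proof (rule newton_coefficients_unique)
      fix x
      have "(\<Sum>n\<le>x. dcoeff (conv_prod s F) n * of_nat (x choose n)) = conv_prod s F (of_nat x)"
        by (rule sums_unique2[OF dpow_series_at_nat hardy_space_dcoeff(2)[OF sF nat_in_half_lattice]])
      also have "\<dots> = (\<Sum>n\<le>x. conv_coeff s F n * of_nat (x choose n))"
        unfolding conv_prod_def by (rule sums_unique[OF dpow_series_at_nat, symmetric])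
      finally show "(\<Sum>n\<le>x. dcoeff (conv_prod s F) n * of_nat (x choose n)) =
          (\<Sum>n\<le>x. conv_coeff s F n * of_nat (x choose n))" .
    qed
    have "(\<Sum>k<N. (cmod (\<Sum>m\<le>k. dcoeff s m * f (k - m)))\<^sup>2) = (\<Sum>k<N. (cmod (conv_coeff s F k))\<^sup>2)"
      by (intro sum.cong refl)
        (auto simp: conv_coeff_def F(2) c_def intro!: arg_cong[where f = cmod] sum.cong)
    also have "\<dots> \<le> (\<Sum>k. (cmod (conv_coeff s F k))\<^sup>2)"
      using hardy_space_dcoeff(1)[OF sF] unfolding d by (intro sum_le_suminf) auto
    also have "\<dots> \<le> (\<Sum>k. (cmod (c k))\<^sup>2)"
      using norm by (simp add: hardy_norm_eq sF F d)
    also have "\<dots> = (\<Sum>k<N. (cmod (c k))\<^sup>2)"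
      by (rule suminf_finite) (auto simp: c_def)
    also have "\<dots> = (\<Sum>k<N. (cmod (f k))\<^sup>2)"
      by (intro sum.cong) (auto simp: c_def)
    finally show "(\<Sum>k<N. (cmod (\<Sum>m\<le>k. dcoeff s m * f (k - m)))\<^sup>2) \<le> (\<Sum>k<N. (cmod (f k))\<^sup>2)" .
  qed
qed


section \<open>Schur functions\<close>

text \<open>\<open>Z\<close> may be applied termwise, and it raises every index by one: the shifted series satisfy
  the step relations that determine the iterates of \<open>Z\<close>.\<close>

lemma Z_iterate_dpow_series:
  assumes c: "summable (\<lambda>n. (cmod (c n))\<^sup>2)"
    and f: "\<And>z. z \<in> half_lattice \<Longrightarrow> (\<lambda>n. c n * dpow n z) sums f z"
    and z: "z \<in> half_lattice"
  shows "(Z_op half_lattice ^^ n) f z = (\<Sum>m. c m * dpow (m + n) z)"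
  using z
proof (induction n arbitrary: z)
  case 0
  then show ?case using sums_unique[OF f] by simp
next
  case (Suc n)
  define G where "G n z = (\<Sum>m. c m * dpow (m + n) z)" for n z
  have G: "(\<lambda>m. c m * dpow (m + n) z) sums G n z" if "z \<in> half_lattice" for n z
  proof -
    obtain B where "\<And>n. cmod (c n) \<le> B"
      using square_summable_bounded[OF c] by blast
    moreover have "summable (\<lambda>m. cmod (dpow (m + n) z))"
      using dpow_abs_summable[OF that] summable_iff_shift[of "\<lambda>n. cmod (dpow n z)"] by simp
    ultimately have "summable (\<lambda>m. cmod (c m * dpow (m + n) z))"
      by (rule summable_bounded_mult)
    then show ?thesis
      unfolding G_def by (rule summable_sums[OF summable_norm_cancel])
  qed
  note mem = lattice_domain_facts(2,3)[OF lattice_domain_half]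
  have "Z_related half_lattice (G n) (G (Suc n))"
    unfolding Z_related_def
  proof (intro conjI ballI)
    show "G (Suc n) 0 = 0" by (simp add: G_def)
  next
    fix z assume z: "z \<in> half_lattice"
    have "(\<lambda>m. c m * dpow (m + Suc n) z + c m * dpow (m + n) z) sums (G (Suc n) z + G n z)"
      by (intro sums_add G z)
    moreover have "c m * dpow (m + Suc n) z + c m * dpow (m + n) z = c m * dpow (m + Suc n) (z + 1)"
      for m
      using dpow_Suc_right[OF z, of "m + n"] by (simp add: algebra_simps)
    ultimately show "G (Suc n) (z + 1) = G (Suc n) z + G n z"
      using sums_unique2[OF G[OF mem(1)[OF z]]] by simp
  next
    fix z assume z: "z \<in> half_lattice"
    have "(\<lambda>m. c m * dpow (m + Suc n) z + (1 + \<i>) / 2 * (c m * dpow (m + n) z) +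
        (\<i> - 1) / 2 * (c m * dpow (m + n) (z + \<i>))) sums
        (G (Suc n) z + (1 + \<i>) / 2 * G n z + (\<i> - 1) / 2 * G n (z + \<i>))"
      by (intro sums_add sums_mult G z mem)
    moreover have "c m * dpow (m + Suc n) z + (1 + \<i>) / 2 * (c m * dpow (m + n) z) +
        (\<i> - 1) / 2 * (c m * dpow (m + n) (z + \<i>)) = c m * dpow (m + Suc n) (z + \<i>)" for m
    proof -
      have "c m * dpow (m + Suc n) (z + \<i>) = c m * (dpow (m + Suc n) z +
          (1 + \<i>) / 2 * dpow (m + n) z + (\<i> - 1) / 2 * dpow (m + n) (z + \<i>))"
        using dpow_Suc_up[OF z, of "m + n"] by simp
      then show ?thesis by (simp only: distrib_left mult.left_commute)
    qed
    ultimately show "G (Suc n) (z + \<i>) =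
        G (Suc n) z + (1 + \<i>) / 2 * G n z + (\<i> - 1) / 2 * G n (z + \<i>)"
      using sums_unique2[OF G[OF mem(2)[OF z]]] by simp
  qed
  moreover have "Z_related half_lattice ((Z_op half_lattice ^^ n) f) ((Z_op half_lattice ^^ Suc n) f)"
    by (rule Z_related_iterate[OF lattice_domain_half dpow_series_discrete_analytic[OF f]])
  ultimately have "G (Suc n) z = (Z_op half_lattice ^^ Suc n) f z"
    by (rule Z_related_unique[OF lattice_domain_half]) (simp_all add: Suc G_def)
  then show ?case by (simp only: G_def)
qed

text \<open>On the nonnegative integers \<open>Z\<close> is summation and shifts the Newton coefficients. This is the
  analogue of the preceding lemma for a function that is not yet known to be a series in the powers.\<close>

lemma Z_iterate_at_nat:
  assumes f: "discrete_analytic_on half_lattice f"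
    and c: "\<And>x. f (of_nat x) = (\<Sum>k\<le>x. c k * of_nat (x choose k))"
  shows "(Z_op half_lattice ^^ n) f (of_nat x) = (\<Sum>k\<le>x. toeplitz c k n * of_nat (x choose k))"
proof (induction n arbitrary: x)
  case 0
  then show ?case by (simp add: c toeplitz_def)
next
  case (Suc n)
  define g where "g = (Z_op half_lattice ^^ Suc n) f"
  have Z: "Z_related half_lattice ((Z_op half_lattice ^^ n) f) g"
    unfolding g_def by (rule Z_related_iterate[OF lattice_domain_half f])
  have shift: "toeplitz c (Suc k) (Suc n) = toeplitz c k n" "toeplitz c 0 (Suc n) = 0" for k
    by (auto simp: toeplitz_def)
  have "g (of_nat x) = (\<Sum>k\<le>x. toeplitz c k (Suc n) * of_nat (x choose k))"
  proof (induction x)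
    case 0
    then show ?case using Z by (simp add: Z_related_def shift)
  next
    case (Suc x)
    have "(\<Sum>k\<le>Suc x. toeplitz c k (Suc n) * of_nat (Suc x choose k)) =
        (\<Sum>k\<le>x. toeplitz c k n * of_nat (x choose k)) +
        (\<Sum>k\<le>x. toeplitz c k n * of_nat (x choose Suc k))"
      by (subst sum.atMost_Suc_shift) (simp add: shift sum.distrib algebra_simps)
    also have "(\<Sum>k\<le>x. toeplitz c k n * of_nat (x choose Suc k)) =
        (\<Sum>k\<le>Suc x. toeplitz c k (Suc n) * of_nat (x choose k))"
      by (subst sum.atMost_Suc_shift) (simp add: shift)
    also have "\<dots> = g (of_nat x)" using Suc by simp
    also have "(\<Sum>k\<le>x. toeplitz c k n * of_nat (x choose k)) = (Z_op half_lattice ^^ n) f (of_nat x)"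
      using \<open>\<And>x. (Z_op half_lattice ^^ n) f (of_nat x) = _ x\<close> by simp
    also have "\<dots> + g (of_nat x) = g (of_nat (Suc x))"
      using Z nat_in_half_lattice[of x] unfolding Z_related_def of_nat_Suc
      by (metis add.commute)
    finally show ?case by simp
  qed
  then show ?case by (simp only: g_def)
qed

text \<open>The binomial matrix is unitriangular, hence invertible on finitely supported sequences: these
  are the combinations of the sequences \<open>dpow n j\<close> with \<open>j\<close> a nonnegative integer.\<close>

lemma binomial_combination:
  fixes u :: "nat \<Rightarrow> complex"
  obtains d where "\<And>k. (\<Sum>j<N. d j * of_nat (j choose k)) = (if k < N then u k else 0)"
proof -
  have "\<exists>d. \<forall>k. (\<Sum>j<N. d j * of_nat (j choose k)) = (if k < N then u k else 0)"
  proof (induction N arbitrary: u)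
    case (Suc N)
    from Suc[of "\<lambda>k. u k - u N * of_nat (N choose k)"]
    obtain d where d: "\<And>k. (\<Sum>j<N. d j * of_nat (j choose k)) =
        (if k < N then u k - u N * of_nat (N choose k) else 0)" by blast
    have "(\<Sum>j<Suc N. (d(N := u N)) j * of_nat (j choose k)) = (if k < Suc N then u k else 0)" for k
    proof -
      have "(\<Sum>j<N. (d(N := u N)) j * of_nat (j choose k)) = (\<Sum>j<N. d j * of_nat (j choose k))"
        by (intro sum.cong) auto
      then show ?thesis by (auto simp: d less_Suc_eq)
    qed
    then show ?case by blast
  qed simp
  then show thesis using that by blast
qed

lemma schur_kernel_positive_iff:
  assumes s: "\<forall>z\<in>half_lattice. summable (\<lambda>n. (cmod ((Z_op half_lattice ^^ n) s z))\<^sup>2)"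
  shows "positive_kernel_on half_lattice (schur_kernel s) \<longleftrightarrow>
    (\<forall>N\<ge>1. \<forall>w c :: nat \<Rightarrow> complex. (\<forall>j\<in>{1..N}. w j \<in> half_lattice) \<longrightarrow>
      (\<Sum>n. (cmod (\<Sum>j=1..N. c j * (Z_op half_lattice ^^ n) s (w j)))\<^sup>2) \<le>
      (\<Sum>n. (cmod (\<Sum>j=1..N. c j * dpow n (w j)))\<^sup>2))"
proof -
  have eq: "(\<Sum>j=1..N. \<Sum>k=1..N. c j * cnj (c k) * schur_kernel s (w k) (w j)) \<in> \<real>\<^sub>\<ge>\<^sub>0 \<longleftrightarrow>
      (\<Sum>n. (cmod (\<Sum>j=1..N. c j * (Z_op half_lattice ^^ n) s (w j)))\<^sup>2) \<le>
      (\<Sum>n. (cmod (\<Sum>j=1..N. c j * dpow n (w j)))\<^sup>2)"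
    if w: "\<forall>j\<in>{1..N}. w j \<in> half_lattice" for N :: nat and w c
    unfolding schur_kernel_def
    by (rule gram_difference_positive_iff)
      (use w s abs_summable_square_summable[OF dpow_abs_summable] in auto)
  show ?thesis
    unfolding positive_kernel_on_def by (intro iff_allI imp_cong refl eq)
qed

lemma discrete_analytic_schur_combination:
  fixes N :: nat
  assumes s: "discrete_analytic_schur s" and w: "\<And>j. j < N \<Longrightarrow> w j \<in> half_lattice"
  shows "summable (\<lambda>n. (cmod (\<Sum>j<N. c j * (Z_op half_lattice ^^ n) s (w j)))\<^sup>2)"
    and "(\<Sum>n. (cmod (\<Sum>j<N. c j * (Z_op half_lattice ^^ n) s (w j)))\<^sup>2) \<le>
      (\<Sum>n. (cmod (\<Sum>j<N. c j * dpow n (w j)))\<^sup>2)"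
proof -
  have Z: "\<forall>z\<in>half_lattice. summable (\<lambda>n. (cmod ((Z_op half_lattice ^^ n) s z))\<^sup>2)"
    using s by (simp add: discrete_analytic_schur_def)
  have "summable (\<lambda>n. (cmod ((Z_op half_lattice ^^ n) s (w j)))\<^sup>2)" if "j \<in> {..<N}" for j
    using Z w that by simp
  from sums_summable[OF sums_square_norm_combination[of "{..<N}"
      "\<lambda>j n. (Z_op half_lattice ^^ n) s (w j)" c, OF this]]
  show "summable (\<lambda>n. (cmod (\<Sum>j<N. c j * (Z_op half_lattice ^^ n) s (w j)))\<^sup>2)"
    unfolding summable_of_real_iff .
  show "(\<Sum>n. (cmod (\<Sum>j<N. c j * (Z_op half_lattice ^^ n) s (w j)))\<^sup>2) \<le>
      (\<Sum>n. (cmod (\<Sum>j<N. c j * dpow n (w j)))\<^sup>2)"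
  proof (cases "N = 0")
    case False
    have P: "positive_kernel_on half_lattice (schur_kernel s)"
      using s by (simp add: discrete_analytic_schur_def)
    have "\<forall>j\<in>{1..N}. w (j - 1) \<in> half_lattice" using w by auto
    with P[unfolded schur_kernel_positive_iff[OF Z], rule_format, of N "\<lambda>j. w (j - 1)" "\<lambda>j. c (j - 1)"]
    show ?thesis
      using False by (simp add: sum.atLeast1_atMost_eq)
  qed simp
qed

text \<open>The positivity of the kernel, tested on one arbitrary point and the integers \<open>0, \<dots>, N - 1\<close>,
  becomes a statement on the sequence of powers at that point plus an arbitrary sequence supported in \<open>{..<N}\<close>.\<close>

lemma discrete_analytic_schur_perturbed_bound:
  assumes s: "discrete_analytic_schur s"
    and c: "\<And>x. s (of_nat x) = (\<Sum>k\<le>x. c k * of_nat (x choose k))"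
    and w: "w \<in> half_lattice"
  shows "summable (\<lambda>n. (cmod (\<alpha> * (Z_op half_lattice ^^ n) s w + (\<Sum>k<N. toeplitz c k n * u k)))\<^sup>2)"
    and "(\<Sum>n. (cmod (\<alpha> * (Z_op half_lattice ^^ n) s w + (\<Sum>k<N. toeplitz c k n * u k)))\<^sup>2) \<le>
      (\<Sum>n. (cmod (\<alpha> * dpow n w + (if n < N then u n else 0)))\<^sup>2)"
proof -
  obtain d where d: "\<And>k. (\<Sum>j<N. d j * of_nat (j choose k)) = (if k < N then u k else 0)"
    using binomial_combination[where u = u and N = N] by blast
  \<comment> \<open>The point \<open>w\<close> followed by the nonnegative integers, with coefficients \<open>\<alpha>\<close> and then \<open>d\<close>.\<close>
  define p where "p = case_nat w of_nat"
  define a where "a = case_nat \<alpha> d"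
  have p: "p j \<in> half_lattice" for j
    using w nat_in_half_lattice by (simp add: p_def split: nat.split)
  have analytic: "discrete_analytic_on half_lattice s"
    using s by (simp add: discrete_analytic_schur_def)
  have "(\<Sum>j<Suc N. a j * dpow n (p j)) = \<alpha> * dpow n w + (if n < N then u n else 0)" for n
    unfolding sum.lessThan_Suc_shift by (simp add: a_def p_def dpow_of_nat d)
  moreover have "(\<Sum>j<Suc N. a j * (Z_op half_lattice ^^ n) s (p j)) =
      \<alpha> * (Z_op half_lattice ^^ n) s w + (\<Sum>k<N. toeplitz c k n * u k)" for n
  proof -
    have "(\<Sum>j<N. d j * (Z_op half_lattice ^^ n) s (of_nat j)) =
        (\<Sum>j<N. d j * (\<Sum>k<N. toeplitz c k n * of_nat (j choose k)))"
    proof (intro sum.cong refl arg_cong2[where f = "(*)"])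
      fix j assume "j \<in> {..<N}"
      then have "(\<Sum>k\<le>j. toeplitz c k n * of_nat (j choose k)) =
          (\<Sum>k<N. toeplitz c k n * of_nat (j choose k))"
        by (intro sum.mono_neutral_left) auto
      then show "(Z_op half_lattice ^^ n) s (of_nat j) = (\<Sum>k<N. toeplitz c k n * of_nat (j choose k))"
        using Z_iterate_at_nat[OF analytic c] by simp
    qed
    also have "\<dots> = (\<Sum>k<N. toeplitz c k n * (\<Sum>j<N. d j * of_nat (j choose k)))"
      unfolding sum_distrib_left by (subst sum.swap) (simp add: mult_ac)
    also have "\<dots> = (\<Sum>k<N. toeplitz c k n * u k)"
      by (simp add: d)
    finally show ?thesis
      unfolding sum.lessThan_Suc_shift by (simp add: a_def p_def)
  qed
  ultimately show "summable (\<lambda>n. (cmod (\<alpha> * (Z_op half_lattice ^^ n) s w + (\<Sum>k<N. toeplitz c k n * u k)))\<^sup>2)"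
    "(\<Sum>n. (cmod (\<alpha> * (Z_op half_lattice ^^ n) s w + (\<Sum>k<N. toeplitz c k n * u k)))\<^sup>2) \<le>
      (\<Sum>n. (cmod (\<alpha> * dpow n w + (if n < N then u n else 0)))\<^sup>2)"
    using discrete_analytic_schur_combination[OF s, of "Suc N" p a] p by simp_all
qed

text \<open>Without the extra point, the perturbed bound is the contractivity of the transposed Toeplitz
  sections. With the extra point \<open>w\<close> and minus the truncated powers at \<open>w\<close>, it bounds the error of the \<open>N\<close>-th
  partial sum at \<open>w\<close> by the tail of a convergent series.\<close>

lemma discrete_analytic_schur_toeplitz:
  assumes s: "discrete_analytic_schur s"
  shows "s \<in> hardy_space" and "toeplitz_contractive (dcoeff s)"
proof -
  obtain c where c: "\<And>x. s (of_nat x) = (\<Sum>k\<le>x. c k * of_nat (x choose k))"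
    using newton_coefficients_exist[of "\<lambda>x. s (of_nat x)"] by blast
  note bound = discrete_analytic_schur_perturbed_bound[OF s c]
  have T: "toeplitz_contractive c"
    unfolding toeplitz_contractive_iff_transpose
  proof (intro allI)
    fix N u
    have "(\<Sum>n<N. (cmod (\<Sum>k<N. toeplitz c k n * u k))\<^sup>2) \<le> (\<Sum>n. (cmod (\<Sum>k<N. toeplitz c k n * u k))\<^sup>2)"
      using bound(1)[OF nat_in_half_lattice, where \<alpha> = 0 and N = N and u = u] by (intro sum_le_suminf) auto
    also have "\<dots> \<le> (\<Sum>n. (cmod (if n < N then u n else 0))\<^sup>2)"
      using bound(2)[OF nat_in_half_lattice, where \<alpha> = 0 and N = N and u = u] by simp
    also have "\<dots> = (\<Sum>k<N. (cmod (if k < N then u k else 0))\<^sup>2)"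
      by (rule suminf_finite) auto
    also have "\<dots> = (\<Sum>k<N. (cmod (u k))\<^sup>2)"
      by (intro sum.cong) auto
    finally show "(\<Sum>n<N. (cmod (\<Sum>k<N. toeplitz c k n * u k))\<^sup>2) \<le> (\<Sum>k<N. (cmod (u k))\<^sup>2)" .
  qed
  have sums: "(\<lambda>n. c n * dpow n w) sums s w" if w: "w \<in> half_lattice" for w
  proof -
    define tail where "tail N = (\<Sum>n. (cmod (dpow n w))\<^sup>2) - (\<Sum>n<N. (cmod (dpow n w))\<^sup>2)" for N
    have v: "summable (\<lambda>n. (cmod (dpow n w))\<^sup>2)"
      by (rule abs_summable_square_summable[OF dpow_abs_summable[OF w]])
    have le: "(cmod ((\<Sum>k<N. c k * dpow k w) - s w))\<^sup>2 \<le> tail N" for N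
    proof -
      let ?y = "\<lambda>n. 1 * (Z_op half_lattice ^^ n) s w + (\<Sum>k<N. toeplitz c k n * (- dpow k w))"
      have "?y 0 = s w - (\<Sum>k<N. c k * dpow k w)"
        by (simp add: toeplitz_def sum_negf)
      then have "(cmod ((\<Sum>k<N. c k * dpow k w) - s w))\<^sup>2 = (cmod (?y 0))\<^sup>2"
        by (simp only: norm_minus_commute)
      also have "\<dots> \<le> (\<Sum>n. (cmod (?y n))\<^sup>2)"
        using sum_le_suminf[OF bound(1)[OF w, where \<alpha> = 1 and N = N and u = "\<lambda>k. - dpow k w"], of "{0}"] by simp
      also have "\<dots> \<le> (\<Sum>n. (cmod (1 * dpow n w + (if n < N then - dpow n w else 0)))\<^sup>2)"
        by (rule bound(2)[OF w])
      also have "\<dots> = (\<Sum>n. (cmod (dpow n w))\<^sup>2 - (if n < N then (cmod (dpow n w))\<^sup>2 else 0))"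
        by (intro suminf_cong) auto
      also have "\<dots> = (\<Sum>n. (cmod (dpow n w))\<^sup>2) - (\<Sum>n. if n < N then (cmod (dpow n w))\<^sup>2 else 0)"
        by (rule suminf_diff[OF v summable_finite[of "{..<N}"], symmetric]) auto
      also have "(\<Sum>n. if n < N then (cmod (dpow n w))\<^sup>2 else 0) =
          (\<Sum>n<N. if n < N then (cmod (dpow n w))\<^sup>2 else 0)"
        by (rule suminf_finite) auto
      also have "\<dots> = (\<Sum>n<N. (cmod (dpow n w))\<^sup>2)"
        by (intro sum.cong) auto
      finally show ?thesis by (simp only: tail_def)
    qed
    have lim: "tail \<longlonglongrightarrow> 0"
      using tendsto_diff[OF tendsto_const summable_LIMSEQ[OF v], of "\<Sum>n. (cmod (dpow n w))\<^sup>2"]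
      by (simp add: tail_def[abs_def])
    have "(\<lambda>N. (cmod ((\<Sum>k<N. c k * dpow k w) - s w))\<^sup>2) \<longlonglongrightarrow> 0"
      by (rule tendsto_sandwich[OF _ _ tendsto_const lim]) (use le in auto)
    from tendsto_real_sqrt[OF this]
    have "(\<lambda>N. cmod ((\<Sum>k<N. c k * dpow k w) - s w)) \<longlonglongrightarrow> 0"
      by simp
    then show ?thesis
      unfolding sums_def by (rule LIM_zero_cancel[OF tendsto_norm_zero_cancel])
  qed
  note c2 = toeplitz_contractive_square_summable[OF T]
  show "s \<in> hardy_space" by (rule hardy_spaceI[OF c2 sums])
  show "toeplitz_contractive (dcoeff s)"
    using T dcoeff_eqI[OF c2 sums] by simp
qed

text \<open>The iterates of \<open>Z\<close> on \<open>s\<close> are the transposed Toeplitz matrix applied to the sequence of powers;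
  by linearity the same holds for combinations over several points.\<close>

lemma toeplitz_discrete_analytic_schur:
  assumes s: "s \<in> hardy_space" and T: "toeplitz_contractive (dcoeff s)"
  shows "discrete_analytic_schur s"
proof -
  note sums = hardy_space_dcoeff(2)[OF s]
  have Z: "(Z_op half_lattice ^^ n) s z = (\<Sum>m. dcoeff s m * dpow (m + n) z)"
    if "z \<in> half_lattice" for n z
    by (rule Z_iterate_dpow_series[OF hardy_space_dcoeff(1)[OF s] sums that])
  have square_summable:
    "\<forall>z\<in>half_lattice. summable (\<lambda>n. (cmod ((Z_op half_lattice ^^ n) s z))\<^sup>2)"
    using toeplitz_contractive_transpose(1)[OF T dpow_abs_summable] by (simp add: Z)
  have "positive_kernel_on half_lattice (schur_kernel s)"
    unfolding schur_kernel_positive_iff[OF square_summable]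
  proof (intro allI impI)
    fix N :: nat and w c :: "nat \<Rightarrow> complex"
    assume w: "\<forall>j\<in>{1..N}. w j \<in> half_lattice"
    define u where "u n = (\<Sum>j=1..N. c j * dpow n (w j))" for n
    have u: "summable (\<lambda>n. cmod (u n))"
    proof (rule summable_comparison_test'[where N = 0])
      show "summable (\<lambda>n. \<Sum>j=1..N. cmod (c j) * cmod (dpow n (w j)))"
        using w by (intro summable_sum summable_mult dpow_abs_summable) auto
      show "norm (cmod (u n)) \<le> (\<Sum>j=1..N. cmod (c j) * cmod (dpow n (w j)))" for n
        unfolding u_def by (simp add: norm_mult[symmetric] norm_sum)
    qed
    have "(\<Sum>j=1..N. c j * (Z_op half_lattice ^^ n) s (w j)) = (\<Sum>m. dcoeff s m * u (m + n))" for n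
    proof -
      have "(\<lambda>m. dcoeff s m * dpow (m + n) z) sums (Z_op half_lattice ^^ n) s z"
        if "z \<in> half_lattice" for z
      proof -
        obtain B where "\<And>n. cmod (dcoeff s n) \<le> B"
          using square_summable_bounded[OF hardy_space_dcoeff(1)[OF s]] by blast
        moreover have "summable (\<lambda>m. cmod (dpow (m + n) z))"
          using dpow_abs_summable[OF that] summable_iff_shift[of "\<lambda>n. cmod (dpow n z)"] by simp
        ultimately have "summable (\<lambda>m. cmod (dcoeff s m * dpow (m + n) z))"
          by (rule summable_bounded_mult)
        then show ?thesis
          unfolding Z[OF that] by (rule summable_sums[OF summable_norm_cancel])
      qed
      then have "(\<lambda>m. \<Sum>j=1..N. c j * (dcoeff s m * dpow (m + n) (w j))) sums
          (\<Sum>j=1..N. c j * (Z_op half_lattice ^^ n) s (w j))"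
        using w by (intro sums_sum sums_mult) auto
      then have "(\<lambda>m. dcoeff s m * u (m + n)) sums (\<Sum>j=1..N. c j * (Z_op half_lattice ^^ n) s (w j))"
        by (simp add: u_def sum_distrib_left mult.left_commute)
      then show ?thesis by (rule sums_unique)
    qed
    then show "(\<Sum>n. (cmod (\<Sum>j=1..N. c j * (Z_op half_lattice ^^ n) s (w j)))\<^sup>2) \<le>
        (\<Sum>n. (cmod (\<Sum>j=1..N. c j * dpow n (w j)))\<^sup>2)"
      using toeplitz_contractive_transpose(2)[OF T u] by (simp add: u_def)
  qed
  then show ?thesis
    using square_summable dpow_series_discrete_analytic[OF sums]
    by (simp add: discrete_analytic_schur_def)
qed

theorem theorem5p2:
  fixes s :: "complex \<Rightarrow> complex"
  shows "(discrete_analytic_schur s \<longrightarrow>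
           s \<in> hardy_space \<and>
           (\<forall>f\<in>hardy_space.
              (\<forall>z\<in>half_lattice. summable (\<lambda>n. cmod (conv_coeff s f n * dpow n z))) \<and>
              discrete_analytic_on half_lattice (conv_prod s f)) \<and>
           hardy_contraction (\<lambda>f. conv_prod s f)) \<and>
         (s \<in> hardy_space \<and> hardy_contraction (\<lambda>f. conv_prod s f) \<longrightarrow>
           discrete_analytic_schur s)"
proof (intro conjI impI ballI)
  assume s: "discrete_analytic_schur s"
  note T = discrete_analytic_schur_toeplitz[OF s]
  show "s \<in> hardy_space" by (rule T(1))
  show "hardy_contraction (\<lambda>f. conv_prod s f)"
    using T(2) by (simp add: hardy_contraction_iff_toeplitz)
  fix f assume f: "f \<in> hardy_space"
  note P = conv_prod_toeplitz_contractive[OF T(2) f]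
  show "discrete_analytic_on half_lattice (conv_prod s f)"
    by (rule dpow_series_discrete_analytic[OF P(3)])
  show "summable (\<lambda>n. cmod (conv_coeff s f n * dpow n z))" if "z \<in> half_lattice" for z
    by (rule dpow_series_abs_summable[OF P(1) that])
next
  assume "s \<in> hardy_space \<and> hardy_contraction (\<lambda>f. conv_prod s f)"
  then show "discrete_analytic_schur s"
    using toeplitz_discrete_analytic_schur hardy_contraction_iff_toeplitz by blast
qed

end
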